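(* Let $G$ be an open subset of $\mathbb{R}$ containing $0$. Let $A$ and $B$ be complex unital Banach algebras with continuous involutions, and let $\pi : G \to \mathcal{B}(A,B)$ be a real analytic map such that for every $\lambda \in G$ the value $\pi(\lambda)$ is a (unital, continuous) $^*$-homomorphism $A \to B$, and such that $\pi(0)$ is surjective. Suppose that for each $x \in \operatorname{Ker}\pi(0)$ we have $\sigma(x) = \{0\}$. Let $q_1, \dots, q_n : G \to S(B)$ be finitely many real analytic maps such that for all $i \neq j$ and each $\lambda \in G$ the idempotents $q_i(\lambda)$ and $q_j(\lambda)$ are orthogonal. Then there exist an open set $H \subset \mathbb{R}$ with $0 \in H \subset G$ and real analytic maps $p_1, \dots, p_n : H \to S(A)$ such that for all $i \neq j$ and each $\lambda \in H$ the idempotents $p_i(\lambda)$ and $p_j(\lambda)$ are orthogonal, and such that $\pi(\lambda)p_i(\lambda) = q_i(\lambda)$ for each $i \in \{1,\dots,n\}$ and each $\lambda \in H$.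
   Context: All Banach algebras are over $\mathbb{C}$ and unital; all Banach algebra homomorphisms are continuous and preserve $1$. $\mathcal{B}(A,B)$ is the Banach space of bounded linear operators from $A$ to $B$ (with the operator norm). For a Banach algebra $A$ with involution $^*$, $S(A) = \{p \in A : p^2 = p = p^*\}$ is the set of self-adjoint idempotents. The involutions are assumed continuous, but not necessarily isometric. A $^*$-homomorphism is an algebra homomorphism commuting with the involutions. A real analytic map $f$ from an open set $G \subset \mathbb{R}$ to a Banach space is a map that near each $x_0 \in G$ has a power series expansion $f(x) = \sum_{n=0}^\infty a_n (x-x_0)^n$ with coefficients $a_n$ in the Banach space; a real analytic map into $S(A)$ is a real analytic map into $A$ with values in $S(A)$. Two idempotents $e, f$ are orthogonal if $ef = fe = 0$. $\sigma(x)$ denotes the spectrum of $x$; for $x \in \operatorname{Ker}\pi(0) \subset A$ it is taken with respect to $A$. *)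

theory Defs
  imports "HOL-Analysis.Analysis"
begin

text \<open>
  Complex unital Banach algebras, with submultiplicative norm and \<open>norm 1 = 1\<close> (both inherited from
  \<^class>\<open>real_normed_algebra_1\<close>). As the library has complex scalar multiplication on no abstract
  class, it is added here to the real structure, which it extends.
\<close>

class complex_banach_algebra_1 = real_normed_algebra_1 + banach +
  fixes scaleC :: "complex \<Rightarrow> 'a \<Rightarrow> 'a" (infixr "*\<^sub>C" 75)
  assumes scaleC_add_right: "c *\<^sub>C (x + y) = c *\<^sub>C x + c *\<^sub>C y"
    and scaleC_add_left: "(c + d) *\<^sub>C x = c *\<^sub>C x + d *\<^sub>C x"
    and scaleC_scaleC: "c *\<^sub>C d *\<^sub>C x = (c * d) *\<^sub>C x"
    and scaleC_of_real: "complex_of_real r *\<^sub>C x = r *\<^sub>R x"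
    and mult_scaleC_left: "(c *\<^sub>C x) * y = c *\<^sub>C (x * y)"
    and mult_scaleC_right: "x * (c *\<^sub>C y) = c *\<^sub>C (x * y)"
    and norm_scaleC: "norm (c *\<^sub>C x) = cmod c * norm x"

definition spectrum :: "'a::complex_banach_algebra_1 \<Rightarrow> complex set" where
  "spectrum x = {z. \<not> (\<exists>y. (z *\<^sub>C 1 - x) * y = 1 \<and> y * (z *\<^sub>C 1 - x) = 1)}"

definition involution :: "('a::complex_banach_algebra_1 \<Rightarrow> 'a) \<Rightarrow> bool" where
  "involution star \<longleftrightarrow>
     (\<forall>x y. star (x + y) = star x + star y) \<and>
     (\<forall>c x. star (c *\<^sub>C x) = cnj c *\<^sub>C star x) \<and>
     (\<forall>x y. star (x * y) = star y * star x) \<and>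
     (\<forall>x. star (star x) = x)"

definition selfadjoint_idempotents :: "('a::complex_banach_algebra_1 \<Rightarrow> 'a) \<Rightarrow> 'a set" where
  "selfadjoint_idempotents star = {p. p * p = p \<and> star p = p}"

definition orthogonal_idempotents :: "'a::complex_banach_algebra_1 \<Rightarrow> 'a \<Rightarrow> bool" where
  "orthogonal_idempotents e f \<longleftrightarrow> e * e = e \<and> f * f = f \<and> e * f = 0 \<and> f * e = 0"

definition unital_star_hom ::
  "('a::complex_banach_algebra_1 \<Rightarrow> 'a) \<Rightarrow> ('b::complex_banach_algebra_1 \<Rightarrow> 'b) \<Rightarrow> ('a \<Rightarrow> 'b) \<Rightarrow> bool"
where
  "unital_star_hom starA starB T \<longleftrightarrow>
     (\<forall>x y. T (x + y) = T x + T y) \<and>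
     (\<forall>c x. T (c *\<^sub>C x) = c *\<^sub>C T x) \<and>
     (\<forall>x y. T (x * y) = T x * T y) \<and>
     T 1 = 1 \<and>
     (\<forall>x. T (starA x) = starB (T x))"

text \<open>
  Meant for open \<open>G\<close>: the neighbourhood of \<open>x\<^sub>0\<close> on which the expansion holds may then be taken
  inside \<open>G\<close>, so the values of \<open>f\<close> outside \<open>G\<close> play no role.

  For maps into the complex-linear bounded operators between complex Banach spaces, this notion is
  applied in the type \<open>'a \<Rightarrow>\<^sub>L 'b\<close> of real-linear bounded operators. The complex-linear ones form a
  closed subspace of it, with the same norm, and the coefficients of an expansion whose values lie
  in a closed subspace lie there too; so the two readings of real analyticity agree.
\<close>

definition real_analytic_on :: "(real \<Rightarrow> 'a::banach) \<Rightarrow> real set \<Rightarrow> bool"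
  (infixl "real'_analytic'_on" 50) where
  "f real_analytic_on G \<longleftrightarrow>
     (\<forall>x\<^sub>0\<in>G. \<exists>a. \<forall>\<^sub>F x in nhds x\<^sub>0. (\<lambda>n. (x - x\<^sub>0) ^ n *\<^sub>R a n) sums f x)"

end

theory Submission
  imports Defs
begin

text \<open>
  A preimage of \<open>q\<^sub>i\<close> under \<open>\<pi>\<close> is found coefficient by coefficient, the open mapping theorem for
  \<open>\<pi>(0)\<close> keeping the radius of convergence positive; averaging with the involution makes it
  self-adjoint, and cutting it down by \<open>1 - (p\<^sub>1 + \<dots> + p\<^sub>k)\<close> on both sides makes it
  orthogonal to the \<open>p\<^sub>i\<close> already found. For the resulting \<open>y(\<lambda>)\<close>, the defect \<open>y(0)\<^sup>2 - y(0)\<close> lies in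
  \<open>Ker \<pi>(0)\<close> and so is quasinilpotent. Hence \<open>(1 + 4(y\<^sup>2 - y))\<^sup>-\<^sup>1\<^sup>/\<^sup>2\<close> is given by its binomial series near
  \<open>\<lambda> = 0\<close>, and \<open>1/2 + (y - 1/2)(1 + 4(y\<^sup>2 - y))\<^sup>-\<^sup>1\<^sup>/\<^sup>2\<close> is the next idempotent. Analyticity needs no
  majorants: the power series with summable coefficients form a Banach algebra,
  in which the binomial series already converges.
\<close>

section \<open>Preimages under a surjective bounded operator\<close>

text \<open>Surjectivity and the condition on the kernel are available at 0 alone, so every
  construction is made on germs at 0, and a common neighbourhood is fixed only at the end. The
  obstacle is that a quasinilpotent defect may have large norm: all that can be used is that some
  power of \<open>4 (y(0)^2 - y(0))\<close> has norm below 1. Majorizing the coefficients of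
  \<open>y\<close> by their norms would destroy exactly this information, since the norm of the
  constant term may exceed 1. In the algebra of summable series it survives: the constant term of a
  power is the power of the constant term, and rescaling the variable makes all other coefficients
  small. The binomial series suits the remaining demands as well. Its coefficients are real, so a
  conjugate-linear involution respects it, and it reduces to its constant term under every linear
  map that kills the positive powers of the defect; one formula thus controls self-adjointness,
  orthogonality and the image under \<pi>.\<close>

lemma surj_bounded_linear_bounded_preimages:
  fixes T :: "'a::banach \<Rightarrow> 'b::banach"
  assumes T: "bounded_linear T" and "surj T"
  obtains K where "K > 0" "\<And>y. \<exists>x. T x = y \<and> norm x \<le> K * norm y"
proof -
  interpret T: bounded_linear T by (rule T)
  define F where "F n = closure (T ` cball 0 (real n))" for n
  have "(\<Union>n. F n) = UNIV"
  proof -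
    have "y \<in> (\<Union>n. F n)" for y
    proof -
      obtain x where "T x = y"
        using \<open>surj T\<close> by (metis surjD)
      moreover obtain n where "norm x \<le> real n"
        using real_arch_simple by blast
      ultimately have "y \<in> F n"
        unfolding F_def using closure_subset by fastforce
      then show ?thesis by blast
    qed
    then show ?thesis by blast
  qed
  then have "\<exists>n. interior (F n) \<noteq> {}"
    using Baire_category_alt[of "euclidean :: 'b topology" "range F"]
    by (force simp: completely_metrizable_space_euclidean F_def)
  then obtain n b where "b \<in> interior (F n)" by blast
  then obtain r where r: "r > 0" "ball b r \<subseteq> F n"
    by (meson mem_interior)
  \<comment> \<open>Both \<open>b + y\<close> and \<open>b\<close> lie in the closure of the image
    of the same ball. Subtracting their approximate preimages moves the ball from \<open>b\<close>
    to the origin; the difference costs the factor 2 in the norm.\<close>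
  have approx: "\<exists>x. norm x \<le> 2 * real n \<and> norm (y - T x) < e" if "norm y < r" "e > 0" for y e
  proof -
    have "b + y \<in> F n" "b \<in> F n"
      using r that by (auto simp: dist_norm subset_iff)
    then obtain u v where u: "norm u \<le> n" "dist (T u) (b + y) < e / 2"
      and v: "norm v \<le> n" "dist (T v) b < e / 2"
      using \<open>e > 0\<close> unfolding F_def closure_approachable
      by (smt (verit, ccfv_threshold) half_gt_zero imageE mem_cball_0)
    have "y - T (u - v) = (T v - b) - (T u - (b + y))"
      by (simp add: T.diff)
    then have "norm (y - T (u - v)) \<le> norm (T v - b) + norm (T u - (b + y))"
      by (metis norm_triangle_ineq4)
    moreover have "norm (u - v) \<le> 2 * real n"
      using u(1) v(1) norm_triangle_ineq4[of u v] by linarith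
    ultimately show ?thesis
      using u(2) v(2) by (intro exI[of _ "u - v"]) (auto simp: dist_norm)
  qed
  \<comment> \<open>A vector rescaled to norm \<open>r / 2\<close> has an approximate preimage of
    norm at most \<open>2 n\<close>. Scaling back multiplies by \<open>2 * norm y / r\<close>, which
    gives the 4; the summand 1 keeps \<open>K\<close> positive when \<open>n = 0\<close>.\<close>
  define K where "K = 4 * (real n + 1) / r"
  have "K > 0" using r(1) by (simp add: K_def)
  have half: "\<exists>x. norm x \<le> K * norm y \<and> norm (y - T x) \<le> norm y / 2" for y
  proof (cases "y = 0")
    case True
    then show ?thesis by (intro exI[of _ 0]) (simp add: T.zero)
  next
    case False
    define k where "k = r / (2 * norm y)"
    have k: "k > 0" using False r by (simp add: k_def)
    have "norm (k *\<^sub>R y) < r" using False r by (simp add: k_def)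
    moreover have "k * norm y / 2 > 0" using k False by simp
    ultimately obtain x where x: "norm x \<le> 2 * real n" "norm (k *\<^sub>R y - T x) < k * norm y / 2"
      using approx by blast
    have "norm (y - T (x /\<^sub>R k)) = norm ((k *\<^sub>R y - T x) /\<^sub>R k)"
      using k by (simp add: T.scaleR algebra_simps)
    also have "\<dots> \<le> norm y / 2"
      using x(2) k by (simp add: divide_simps mult.commute)
    finally have "norm (y - T (x /\<^sub>R k)) \<le> norm y / 2" .
    moreover have "norm (x /\<^sub>R k) \<le> K * norm y"
    proof -
      have "norm (x /\<^sub>R k) = norm x / k"
        using k by (simp add: field_simps)
      also have "\<dots> \<le> 2 * (real n + 1) / k"
        using x(1) k by (intro divide_right_mono) auto
      also have "\<dots> = K * norm y"
        using False r by (simp add: K_def k_def field_simps)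
      finally show ?thesis .
    qed
    ultimately show ?thesis by blast
  qed
  then obtain g where g: "\<And>y. norm (g y) \<le> K * norm y" "\<And>y. norm (y - T (g y)) \<le> norm y / 2"
    by metis
  have "\<exists>x. T x = y \<and> norm x \<le> 2 * K * norm y" for y
  proof -
    \<comment> \<open>\<open>w k\<close> is the residual after \<open>k\<close> corrections. Each
      correction at least halves it, so the corrections form an absolutely convergent series whose
      images telescope to \<open>y\<close>.\<close>
    define w where "w = rec_nat y (\<lambda>_ z. z - T (g z))"
    have w_Suc: "w (Suc k) = w k - T (g (w k))" and w_0: "w 0 = y" for k
      by (simp_all add: w_def)
    have w: "norm (w k) \<le> norm y * (1 / 2) ^ k" for k
    proof (induction k)
      case (Suc k)
      then show ?case using g(2)[of "w k"] by (simp add: w_Suc)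
    qed (simp add: w_0)
    have gw: "norm (g (w k)) \<le> K * norm y * (1 / 2) ^ k" for k
      using order_trans[OF g(1) mult_left_mono[OF w, of K]] \<open>K > 0\<close> by (simp add: mult_ac)
    have geo: "(\<lambda>k. K * norm y * (1 / 2) ^ k) sums (2 * K * norm y)"
      using sums_mult[OF geometric_sums[of "1/2 :: real"], of "K * norm y"]
      by (simp add: mult_ac)
    have sg: "summable (\<lambda>k. g (w k))"
      by (rule summable_comparison_test'[OF sums_summable[OF geo], of 0]) (rule gw)
    have "w \<longlonglongrightarrow> 0"
    proof (rule Lim_null_comparison)
      show "\<forall>\<^sub>F k in sequentially. norm (w k) \<le> norm y * (1 / 2) ^ k"
        using w by simp
      show "(\<lambda>k. norm y * (1 / 2) ^ k) \<longlonglongrightarrow> 0"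
        by (intro tendsto_mult_right_zero LIMSEQ_power_zero) simp
    qed
    then have "(\<lambda>k. w k - w (Suc k)) sums (w 0 - 0)"
      by (rule telescope_sums')
    then have "(\<lambda>k. T (g (w k))) sums y"
      by (simp add: w_Suc w_0)
    moreover have "(\<lambda>k. T (g (w k))) sums T (\<Sum>k. g (w k))"
      using sg by (intro T.sums summable_sums)
    ultimately have "T (\<Sum>k. g (w k)) = y"
      by (simp add: sums_unique2)
    moreover have "norm (\<Sum>k. g (w k)) \<le> 2 * K * norm y"
      using norm_sums_le[OF summable_sums[OF sg] geo] gw by blast
    ultimately show ?thesis by blast
  qed
  then show thesis
    using \<open>K > 0\<close> that[of "2 * K"] by auto
qed

text \<open>The double family is absolutely summable, so its sum by rows, which is
  \<open>prod F G\<close>, equals its sum along the antidiagonals. A general pairing is needed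
  because operator coefficients will be applied to vector coefficients.\<close>

lemma Cauchy_product_sums_bilinear:
  fixes f :: "nat \<Rightarrow> 'a::real_normed_vector" and g :: "nat \<Rightarrow> 'b::real_normed_vector"
    and prod :: "'a \<Rightarrow> 'b \<Rightarrow> 'c::banach"
  assumes "bounded_bilinear prod"
    and f: "summable (\<lambda>k. norm (f k))" "(f has_sum F) UNIV"
    and g: "summable (\<lambda>k. norm (g k))" "(g has_sum G) UNIV"
  shows "(\<lambda>n. \<Sum>i\<le>n. prod (f i) (g (n - i))) sums prod F G"
proof -
  interpret bounded_bilinear prod by fact
  obtain K where K: "\<And>a b. norm (prod a b) \<le> norm a * norm b * K"
    using nonneg_bounded by blast
  let ?h = "\<lambda>(i, j). prod (f i) (g j)"
  have "(\<lambda>(i, j). norm (f i) * norm (g j)) summable_on (UNIV \<times> UNIV)"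
  proof (rule summable_on_SigmaI[where g = "\<lambda>i. norm (f i) * (\<Sum>j. norm (g j))"])
    fix i
    have "((\<lambda>j. norm (g j)) has_sum (\<Sum>j. norm (g j))) UNIV"
      using g(1) by (intro norm_summable_imp_has_sum) auto
    then show "((\<lambda>j. case (i, j) of (i, j) \<Rightarrow> norm (f i) * norm (g j)) has_sum
        norm (f i) * (\<Sum>j. norm (g j))) UNIV"
      by (simp add: has_sum_cmult_right)
  next
    have "(\<lambda>i. norm (f i)) summable_on UNIV"
      using f(1) by (intro norm_summable_imp_summable_on) simp
    then show "(\<lambda>i. norm (f i) * (\<Sum>j. norm (g j))) summable_on UNIV"
      by (rule summable_on_cmult_left)
  qed auto
  then have "(\<lambda>p. (case p of (i, j) \<Rightarrow> norm (f i) * norm (g j)) * K) summable_on (UNIV \<times> UNIV)"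
    by (rule summable_on_cmult_left)
  then have "(\<lambda>p. norm (?h p)) summable_on (UNIV \<times> UNIV)"
    by (rule Infinite_Sum.abs_summable_on_comparison_test') (simp add: split_beta K)
  then have summ: "?h summable_on (UNIV \<times> UNIV)"
    by (rule Infinite_Sum.abs_summable_summable)
  have "(?h has_sum prod F G) (UNIV \<times> UNIV)"
  proof (rule has_sum_SigmaI[OF _ _ summ])
    show "((\<lambda>j. ?h (i, j)) has_sum prod (f i) G) UNIV" for i
      using has_sum_bounded_linear[OF bounded_linear_right g(2), of "f i"] by (simp add: o_def)
    show "((\<lambda>i. prod (f i) G) has_sum prod F G) UNIV"
      using has_sum_bounded_linear[OF bounded_linear_left f(2), of G] by (simp add: o_def)
  qed
  also have "(?h has_sum prod F G) (UNIV \<times> UNIV) \<longleftrightarrow>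
      ((\<lambda>(n, i). prod (f i) (g (n - i))) has_sum prod F G) (SIGMA n:UNIV. {..n})"
    by (rule has_sum_reindex_bij_witness[where j = "\<lambda>(i, j). (i + j, i)" and i = "\<lambda>(n, i). (i, n - i)"])
      auto
  finally have "((\<lambda>n. \<Sum>i\<le>n. prod (f i) (g (n - i))) has_sum prod F G) UNIV"
    by (rule has_sum_SigmaD) (simp add: has_sum_finite)
  then show ?thesis
    by (rule has_sum_imp_sums)
qed

section \<open>Power series at a point\<close>

definition has_power_series_at :: "(real \<Rightarrow> 'a::real_normed_vector) \<Rightarrow> real \<Rightarrow> bool" where
  "has_power_series_at f x\<^sub>0 \<longleftrightarrow> (\<exists>a. \<forall>\<^sub>F x in nhds x\<^sub>0. (\<lambda>n. (x - x\<^sub>0) ^ n *\<^sub>R a n) sums f x)"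

lemma real_analytic_on_iff: "f real_analytic_on G \<longleftrightarrow> (\<forall>x\<in>G. has_power_series_at f x)"
  by (simp add: real_analytic_on_def has_power_series_at_def)

lemma power_series_coeffs_bounded:
  fixes a :: "nat \<Rightarrow> 'a::real_normed_vector"
  assumes "\<forall>\<^sub>F x in nhds x\<^sub>0. (\<lambda>n. (x - x\<^sub>0) ^ n *\<^sub>R a n) sums f x"
  obtains c M where "c > 0" "\<And>n. norm (a n) * c ^ n \<le> M"
proof -
  obtain e where e: "e > 0" "\<And>x. dist x x\<^sub>0 < e \<Longrightarrow> (\<lambda>n. (x - x\<^sub>0) ^ n *\<^sub>R a n) sums f x"
    using assms unfolding eventually_nhds_metric by blast
  define c where "c = e / 2"
  have "c > 0" using e(1) by (simp add: c_def)
  have "(\<lambda>n. c ^ n *\<^sub>R a n) sums f (x\<^sub>0 + c)"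
    using e(2)[of "x\<^sub>0 + c"] \<open>e > 0\<close> by (simp add: c_def dist_real_def)
  then have "Bseq (\<lambda>n. c ^ n *\<^sub>R a n)"
    using sums_summable summable_imp_Bseq by blast
  then obtain M where "\<And>n. norm (c ^ n *\<^sub>R a n) \<le> M"
    unfolding Bseq_def by blast
  then show thesis
    using \<open>c > 0\<close> by (intro that[of c M]) (auto simp: mult.commute)
qed

lemma power_series_coeffs_summable:
  fixes a :: "nat \<Rightarrow> 'a::real_normed_vector"
  assumes bound: "\<And>n. norm (a n) * c ^ n \<le> M" and s: "0 \<le> s" "s < c"
  shows "summable (\<lambda>n. norm (a n) * s ^ n)"
proof (rule summable_comparison_test)
  have "norm (norm (a n) * s ^ n) \<le> M * (s / c) ^ n" for n
    using mult_right_mono[OF bound[of n], of "(s / c) ^ n"] s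
    by (simp add: power_divide)
  then show "\<exists>N. \<forall>n\<ge>N. norm (norm (a n) * s ^ n) \<le> M * (s / c) ^ n" by blast
  show "summable (\<lambda>n. M * (s / c) ^ n)"
    using s by (intro summable_mult summable_geometric) auto
qed

lemma power_series_value_at_center:
  fixes a :: "nat \<Rightarrow> 'a::real_normed_vector"
  assumes "\<forall>\<^sub>F x in nhds x\<^sub>0. (\<lambda>n. (x - x\<^sub>0) ^ n *\<^sub>R a n) sums f x"
  shows "f x\<^sub>0 = a 0"
proof -
  have "(\<lambda>n. (x\<^sub>0 - x\<^sub>0) ^ n *\<^sub>R a n) sums f x\<^sub>0"
    using assms by (rule eventually_nhds_x_imp_x)
  moreover have "(\<lambda>n. (x\<^sub>0 - x\<^sub>0) ^ n *\<^sub>R a n) sums a 0"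
    using sums_finite[of "{0}" "\<lambda>n. (x\<^sub>0 - x\<^sub>0) ^ n *\<^sub>R a n"] by simp
  ultimately show ?thesis
    by (rule sums_unique2)
qed

text \<open>Equating coefficients in \<open>F x (f x) = q x\<close> leaves a triangular system:
  \<open>a 0\<close> applied to the n-th unknown is a remainder \<open>r n\<close> made of earlier
  unknowns. Only \<open>a 0\<close>, the value of \<open>F\<close> at the centre, has to be
  inverted.\<close>

lemma has_power_series_at_lift:
  fixes F :: "real \<Rightarrow> 'a::banach \<Rightarrow>\<^sub>L 'b::banach"
  assumes "has_power_series_at F x\<^sub>0" "has_power_series_at q x\<^sub>0" and surj: "surj (F x\<^sub>0)"
  obtains f where "has_power_series_at f x\<^sub>0" "\<forall>\<^sub>F x in nhds x\<^sub>0. F x (f x) = q x"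
proof -
  obtain a where a: "\<forall>\<^sub>F x in nhds x\<^sub>0. (\<lambda>n. (x - x\<^sub>0) ^ n *\<^sub>R a n) sums F x"
    using assms(1) unfolding has_power_series_at_def by blast
  obtain b where b: "\<forall>\<^sub>F x in nhds x\<^sub>0. (\<lambda>n. (x - x\<^sub>0) ^ n *\<^sub>R b n) sums q x"
    using assms(2) unfolding has_power_series_at_def by blast
  have a0: "F x\<^sub>0 = a 0"
    using a by (rule power_series_value_at_center)
  obtain K where K: "K > 0" "\<And>y. \<exists>x. a 0 x = y \<and> norm x \<le> K * norm y"
    using surj_bounded_linear_bounded_preimages[OF blinfun.bounded_linear_right surj] a0 by metis
  obtain c1 M1 where c1: "c1 > 0" "\<And>n. norm (a n) * c1 ^ n \<le> M1"
    using a by (rule power_series_coeffs_bounded) blast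
  obtain c2 M2 where c2: "c2 > 0" "\<And>n. norm (b n) * c2 ^ n \<le> M2"
    using b by (rule power_series_coeffs_bounded) blast
  define c where "c = min c1 c2"
  define M where "M = max M1 M2"
  have "c > 0" using c1 c2 by (simp add: c_def)
  have aM: "norm (a n) * c ^ n \<le> M" for n
    using mult_left_mono[OF power_mono[of c c1 n], of "norm (a n)"] c1 c2
    by (fastforce simp: c_def M_def intro: order_trans)
  have bM: "norm (b n) * c ^ n \<le> M" for n
    using mult_left_mono[OF power_mono[of c c2 n], of "norm (b n)"] c1 c2
    by (fastforce simp: c_def M_def intro: order_trans)
  define r where "r n x = b n - (\<Sum>k<n. a (n - k) (x k))" for n and x :: "nat \<Rightarrow> 'a"
  \<comment> \<open>Preimages under \<open>a 0\<close> are not unique, so each choice depends on all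
    earlier ones. The norm bound belongs to the choice, as the radius of convergence rests on
    it.\<close>
  have "\<exists>x. \<forall>n. a 0 (x n) = r n x \<and> norm (x n) \<le> K * norm (r n x)"
  proof (rule dependent_wellorder_choice)
    show "\<exists>z. a 0 z = r n x \<and> norm z \<le> K * norm (r n x)" for n x
      by (rule K(2))
    show "(a 0 z = r n f \<and> norm z \<le> K * norm (r n f)) = (a 0 z = r n g \<and> norm z \<le> K * norm (r n g))"
      if "\<And>k. k < n \<Longrightarrow> f k = g k" for z f g n
    proof -
      have "r n f = r n g" using that by (simp add: r_def)
      then show ?thesis by simp
    qed
  qed
  then obtain x where x: "\<And>n. a 0 (x n) = r n x" "\<And>n. norm (x n) \<le> K * norm (r n x)"
    by blast
  have conv: "(\<Sum>k\<le>n. a (n - k) (x k)) = b n" for n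
    using x(1)[of n] by (simp add: r_def flip: lessThan_Suc_atMost)
  define L where "L = K * M"
  have "M \<ge> 0" using aM[of 0] order_trans[OF norm_ge_zero[of "a 0"], of M] by simp
  then have "L \<ge> 0" using K(1) by (simp add: L_def)
  have step: "norm (x n) * c ^ n \<le> L * (1 + (\<Sum>k<n. norm (x k) * c ^ k))" for n
  proof -
    have "norm (x n) * c ^ n \<le> K * norm (r n x) * c ^ n"
      using x(2)[of n] \<open>c > 0\<close> by (intro mult_right_mono) auto
    also have "\<dots> \<le> K * (norm (b n) + (\<Sum>k<n. norm (a (n - k)) * norm (x k))) * c ^ n"
    proof -
      have "norm (r n x) \<le> norm (b n) + (\<Sum>k<n. norm (a (n - k)) * norm (x k))"
        unfolding r_def
        by (intro order_trans[OF norm_triangle_ineq4] add_left_mono order_trans[OF norm_sum] sum_mono norm_blinfun)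
      then show ?thesis
        using K(1) \<open>c > 0\<close> by (intro mult_right_mono mult_left_mono) auto
    qed
    also have "\<dots> = K * (norm (b n) * c ^ n + (\<Sum>k<n. norm (a (n - k)) * c ^ (n - k) * (norm (x k) * c ^ k)))"
    proof -
      have "(\<Sum>k<n. norm (a (n - k)) * norm (x k)) * c ^ n
          = (\<Sum>k<n. norm (a (n - k)) * c ^ (n - k) * (norm (x k) * c ^ k))"
        unfolding sum_distrib_right by (intro sum.cong) (auto simp: mult_ac simp flip: power_add)
      then show ?thesis
        by (simp add: distrib_right mult.assoc)
    qed
    also have "\<dots> \<le> K * (M + (\<Sum>k<n. M * (norm (x k) * c ^ k)))"
      using K(1) \<open>c > 0\<close> by (intro mult_left_mono add_mono bM sum_mono mult_right_mono aM) auto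
    also have "\<dots> = L * (1 + (\<Sum>k<n. norm (x k) * c ^ k))"
      by (simp add: L_def algebra_simps sum_distrib_left)
    finally show ?thesis .
  qed
  \<comment> \<open>By \<open>step\<close>, one more term multiplies \<open>1 +\<close> the partial
    sum by at most \<open>1 + L\<close>, so the growth is geometric.\<close>
  have xL: "1 + (\<Sum>k<n. norm (x k) * c ^ k) \<le> (1 + L) ^ n" for n
  proof (induction n)
    case (Suc n)
    have "1 + (\<Sum>k<Suc n. norm (x k) * c ^ k) \<le> (1 + L) * (1 + (\<Sum>k<n. norm (x k) * c ^ k))"
      using step[of n] by (simp add: algebra_simps)
    also have "\<dots> \<le> (1 + L) * (1 + L) ^ n"
      using Suc \<open>L \<ge> 0\<close> by (intro mult_left_mono) auto
    finally show ?case by simp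
  qed simp
  \<comment> \<open>Dividing the radius by \<open>1 + L\<close> cancels that growth.\<close>
  define d where "d = c / (1 + L)"
  have d: "d > 0" "d \<le> c"
    using \<open>c > 0\<close> \<open>L \<ge> 0\<close> by (auto simp: d_def divide_simps mult_le_cancel_left)
  have xd: "norm (x n) * d ^ n \<le> L" for n
  proof -
    have "norm (x n) * c ^ n \<le> L * (1 + L) ^ n"
      using step[of n] mult_left_mono[OF xL[of n] \<open>L \<ge> 0\<close>] by linarith
    then show ?thesis
      using \<open>L \<ge> 0\<close> by (simp add: d_def power_divide divide_simps)
  qed
  define f where "f y = (\<Sum>n. (y - x\<^sub>0) ^ n *\<^sub>R x n)" for y
  have near: "\<forall>\<^sub>F y in nhds x\<^sub>0. \<bar>y - x\<^sub>0\<bar> < d"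
    using d(1) by (auto simp: eventually_nhds_metric dist_real_def)
  have xs: "summable (\<lambda>n. norm ((y - x\<^sub>0) ^ n *\<^sub>R x n))" if "\<bar>y - x\<^sub>0\<bar> < d" for y
    using power_series_coeffs_summable[OF xd _ that] by (simp add: power_abs mult.commute)
  have as: "summable (\<lambda>n. norm ((y - x\<^sub>0) ^ n *\<^sub>R a n))" if "\<bar>y - x\<^sub>0\<bar> < d" for y
    using power_series_coeffs_summable[OF aM, of "\<bar>y - x\<^sub>0\<bar>"] that d by (simp add: power_abs mult.commute)
  have fs: "(\<lambda>n. (y - x\<^sub>0) ^ n *\<^sub>R x n) sums f y" if "\<bar>y - x\<^sub>0\<bar> < d" for y
    unfolding f_def by (rule summable_sums[OF summable_norm_cancel[OF xs[OF that]]])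
  show thesis
  proof (rule that)
    show "has_power_series_at f x\<^sub>0"
      unfolding has_power_series_at_def by (rule exI[of _ x]) (rule eventually_mono[OF near fs])
    show "\<forall>\<^sub>F y in nhds x\<^sub>0. F y (f y) = q y"
      using near a b
    proof eventually_elim
      case (elim y)
      \<comment> \<open>The evaluation pairing is flipped so that the index \<open>i\<close> goes to
        the vectors and \<open>n - i\<close> to the operators, as in \<open>conv\<close>.\<close>
      have "(\<lambda>n. \<Sum>i\<le>n. (\<lambda>v T. blinfun_apply T v) ((y - x\<^sub>0) ^ i *\<^sub>R x i) ((y - x\<^sub>0) ^ (n - i) *\<^sub>R a (n - i)))
          sums (\<lambda>v T. blinfun_apply T v) (f y) (F y)"
        using elim xs[of y] as[of y] fs[of y]
        by (intro Cauchy_product_sums_bilinear norm_summable_imp_has_sum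
            bounded_bilinear.flip[OF bounded_bilinear_blinfun_apply]) auto
      also have "(\<lambda>n. \<Sum>i\<le>n. (\<lambda>v T. blinfun_apply T v) ((y - x\<^sub>0) ^ i *\<^sub>R x i) ((y - x\<^sub>0) ^ (n - i) *\<^sub>R a (n - i)))
          = (\<lambda>n. (y - x\<^sub>0) ^ n *\<^sub>R b n)"
      proof
        fix n
        have "(\<Sum>i\<le>n. (\<lambda>v T. blinfun_apply T v) ((y - x\<^sub>0) ^ i *\<^sub>R x i) ((y - x\<^sub>0) ^ (n - i) *\<^sub>R a (n - i)))
            = (\<Sum>i\<le>n. (y - x\<^sub>0) ^ n *\<^sub>R a (n - i) (x i))"
          by (intro sum.cong) (auto simp: blinfun.scaleR_left blinfun.scaleR_right simp flip: power_add)
        then show "(\<Sum>i\<le>n. (\<lambda>v T. blinfun_apply T v) ((y - x\<^sub>0) ^ i *\<^sub>R x i) ((y - x\<^sub>0) ^ (n - i) *\<^sub>R a (n - i)))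
            = (y - x\<^sub>0) ^ n *\<^sub>R b n"
          by (simp add: conv flip: scaleR_sum_right)
      qed
      finally show ?case
        using elim sums_unique2 by blast
    qed
  qed
qed

section \<open>The Banach algebra of absolutely summable power series\<close>

text \<open>The carrier consists of formal power series rather than plain sequences, so that
  multiplication is the Cauchy product and the ring laws come by transfer.\<close>

typedef (overloaded) 'a l1 = "{f :: 'a::real_normed_vector fps. summable (\<lambda>n. norm (fps_nth f n))}"
  morphisms fps_of_l1 l1_of_fps
  by (intro exI[of _ 0]) simp

setup_lifting type_definition_l1

lift_definition l1_nth :: "'a::real_normed_vector l1 \<Rightarrow> nat \<Rightarrow> 'a" is fps_nth .

lemma l1_eq_iff: "f = g \<longleftrightarrow> (\<forall>n. l1_nth f n = l1_nth g n)"
  by transfer (simp add: fps_eq_iff)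

lemma summable_norm_l1_nth: "summable (\<lambda>n. norm (l1_nth f n))"
  by transfer simp

lift_definition l1_of_seq :: "(nat \<Rightarrow> 'a) \<Rightarrow> 'a::real_normed_vector l1" is
  "\<lambda>a. if summable (\<lambda>n. norm (a n)) then Abs_fps a else 0"
  by auto

lemma l1_nth_of_seq: "summable (\<lambda>n. norm (a n)) \<Longrightarrow> l1_nth (l1_of_seq a) n = a n"
  by transfer simp

lemma
  fixes a b :: "nat \<Rightarrow> 'a::real_normed_vector"
  assumes "summable (\<lambda>n. norm (a n))" "summable (\<lambda>n. norm (b n))"
  shows summable_norm_add: "summable (\<lambda>n. norm (a n + b n))"
    and summable_norm_diff: "summable (\<lambda>n. norm (a n - b n))"
  by (rule summable_comparison_test'[OF summable_add[OF assms], of 0];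
      simp add: norm_triangle_ineq norm_triangle_ineq4)+

instantiation l1 :: (real_normed_vector) real_vector
begin

lift_definition zero_l1 :: "'a l1" is 0
  by simp

lift_definition plus_l1 :: "'a l1 \<Rightarrow> 'a l1 \<Rightarrow> 'a l1" is "(+)"
  by (simp add: summable_norm_add)

lift_definition minus_l1 :: "'a l1 \<Rightarrow> 'a l1 \<Rightarrow> 'a l1" is "(-)"
  by (simp add: summable_norm_diff)

lift_definition uminus_l1 :: "'a l1 \<Rightarrow> 'a l1" is uminus
  by simp

lift_definition scaleR_l1 :: "real \<Rightarrow> 'a l1 \<Rightarrow> 'a l1" is "\<lambda>r f. Abs_fps (\<lambda>n. r *\<^sub>R fps_nth f n)"
  by (simp add: summable_mult)

lemma l1_nth_zero: "l1_nth (0 :: 'a l1) n = 0"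
  and l1_nth_add: "l1_nth (f + g :: 'a l1) n = l1_nth f n + l1_nth g n"
  and l1_nth_diff: "l1_nth (f - g :: 'a l1) n = l1_nth f n - l1_nth g n"
  and l1_nth_scaleR: "l1_nth (r *\<^sub>R f :: 'a l1) n = r *\<^sub>R l1_nth f n"
  by (transfer; simp)+

instance
proof
  fix f g h :: "'a l1" and r s :: real
  show "f + g + h = f + (g + h)" "f + g = g + f" "0 + f = f" "- f + f = 0" "f - g = f + - g"
    by (transfer; simp add: algebra_simps)+
  show "r *\<^sub>R (f + g) = r *\<^sub>R f + r *\<^sub>R g" "(r + s) *\<^sub>R f = r *\<^sub>R f + s *\<^sub>R f"
    "r *\<^sub>R s *\<^sub>R f = (r * s) *\<^sub>R f" "1 *\<^sub>R f = f"
    by (simp_all add: l1_eq_iff l1_nth_add l1_nth_scaleR algebra_simps)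
qed

end

section \<open>The norm of absolute summation and its completeness\<close>

instantiation l1 :: (real_normed_vector) real_normed_vector
begin

definition norm_l1 :: "'a l1 \<Rightarrow> real" where
  "norm_l1 f = (\<Sum>n. norm (l1_nth f n))"

definition sgn_l1 :: "'a l1 \<Rightarrow> 'a l1" where
  "sgn_l1 f = f /\<^sub>R norm f"

definition dist_l1 :: "'a l1 \<Rightarrow> 'a l1 \<Rightarrow> real" where
  "dist_l1 f g = norm (f - g)"

definition uniformity_l1 :: "('a l1 \<times> 'a l1) filter" where
  "uniformity_l1 = (INF e\<in>{0 <..}. principal {(x, y). dist x y < e})"

definition open_l1 :: "'a l1 set \<Rightarrow> bool" where
  "open_l1 U = (\<forall>x\<in>U. \<forall>\<^sub>F (x', y) in uniformity. x' = x \<longrightarrow> y \<in> U)"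

instance
proof
  fix f g :: "'a l1" and r :: real
  show "dist f g = norm (f - g)" by (rule dist_l1_def)
  show "sgn f = f /\<^sub>R norm f" by (rule sgn_l1_def)
  show "uniformity = (INF e\<in>{0 <..}. principal {(x, y :: 'a l1). dist x y < e})"
    by (rule uniformity_l1_def)
  show "open U \<longleftrightarrow> (\<forall>x\<in>U. \<forall>\<^sub>F (x', y) in uniformity. x' = x \<longrightarrow> y \<in> U)" for U :: "'a l1 set"
    by (rule open_l1_def)
  show "norm f = 0 \<longleftrightarrow> f = 0"
    using suminf_eq_zero_iff[OF summable_norm_l1_nth[of f]]
    by (simp add: norm_l1_def l1_eq_iff l1_nth_zero)
  have "norm (f + g) \<le> (\<Sum>n. norm (l1_nth f n) + norm (l1_nth g n))"
    unfolding norm_l1_def l1_nth_add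
    by (intro suminf_le norm_triangle_ineq summable_add summable_norm_l1_nth)
      (simp add: summable_norm_l1_nth flip: l1_nth_add)
  also have "\<dots> = norm f + norm g"
    unfolding norm_l1_def by (intro suminf_add[symmetric] summable_norm_l1_nth)
  finally show "norm (f + g) \<le> norm f + norm g" .
  show "norm (r *\<^sub>R f) = \<bar>r\<bar> * norm f"
    by (simp add: norm_l1_def l1_nth_scaleR suminf_mult summable_norm_l1_nth)
qed

end

lemma norm_l1_nth_le: "norm (l1_nth f n) \<le> norm f"
  unfolding norm_l1_def
  using sum_le_suminf[OF summable_norm_l1_nth[of f], of "{n}"] by simp

instance l1 :: (banach) banach
proof
  fix X :: "nat \<Rightarrow> 'a l1"
  assume X: "Cauchy X"
  have "Cauchy (\<lambda>m. l1_nth (X m) n)" for n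
  proof (rule CauchyI)
    fix e :: real assume "e > 0"
    then obtain M where "\<forall>m\<ge>M. \<forall>k\<ge>M. norm (X m - X k) < e"
      using CauchyD[OF X] by blast
    then show "\<exists>M. \<forall>m\<ge>M. \<forall>k\<ge>M. norm (l1_nth (X m) n - l1_nth (X k) n) < e"
      using norm_l1_nth_le[of "X _ - X _" n] by (metis l1_nth_diff le_less_trans)
  qed
  then have "\<forall>n. \<exists>l. (\<lambda>m. l1_nth (X m) n) \<longlonglongrightarrow> l"
    using Cauchy_convergent unfolding convergent_def by blast
  then obtain a where a: "\<And>n. (\<lambda>m. l1_nth (X m) n) \<longlonglongrightarrow> a n"
    by metis
  \<comment> \<open>The limit in \<open>k\<close> is taken in finite partial sums only. As the terms
    are nonnegative, the uniform bound on these yields both the summability of the differences and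
    the estimate of their norm.\<close>
  have tail: "summable (\<lambda>n. norm (l1_nth (X m) n - a n)) \<and> (\<Sum>n. norm (l1_nth (X m) n - a n)) \<le> e"
    if M: "\<forall>m\<ge>M. \<forall>k\<ge>M. norm (X m - X k) < e" and m: "m \<ge> M" for M m e
  proof -
    have partial: "(\<Sum>n<N. norm (l1_nth (X m) n - a n)) \<le> e" for N
    proof (rule LIMSEQ_le_const2)
      show "(\<lambda>k. \<Sum>n<N. norm (l1_nth (X m) n - l1_nth (X k) n)) \<longlonglongrightarrow> (\<Sum>n<N. norm (l1_nth (X m) n - a n))"
        by (intro tendsto_intros a)
      have "(\<Sum>n<N. norm (l1_nth (X m) n - l1_nth (X k) n)) \<le> e" if "k \<ge> M" for k
      proof -
        have "(\<Sum>n<N. norm (l1_nth (X m - X k) n)) \<le> norm (X m - X k)"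
          unfolding norm_l1_def by (intro sum_le_suminf summable_norm_l1_nth) auto
        then show ?thesis using M m that by (force simp: l1_nth_diff)
      qed
      then show "\<exists>K. \<forall>k\<ge>K. (\<Sum>n<N. norm (l1_nth (X m) n - l1_nth (X k) n)) \<le> e" by blast
    qed
    have "summable (\<lambda>n. norm (l1_nth (X m) n - a n))"
      using partial by (intro summableI_nonneg_bounded) auto
    then show ?thesis
      using partial by (auto intro: suminf_le_const)
  qed
  have "summable (\<lambda>n. norm (a n))"
  proof -
    obtain M where "\<forall>m\<ge>M. \<forall>k\<ge>M. norm (X m - X k) < 1"
      using CauchyD[OF X, of 1] by auto
    then have "summable (\<lambda>n. norm (l1_nth (X M) n - a n))"
      using tail by blast
    then have "summable (\<lambda>n. norm (l1_nth (X M) n - a n) + norm (l1_nth (X M) n))"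
      by (intro summable_add summable_norm_l1_nth)
    then show ?thesis
      by (rule summable_comparison_test'[where N = 0])
        (metis add.commute norm_minus_commute norm_triangle_sub real_norm_def abs_norm_cancel)
  qed
  then have nth: "l1_nth (l1_of_seq a) n = a n" for n
    by (rule l1_nth_of_seq)
  have "X \<longlonglongrightarrow> l1_of_seq a"
  proof (rule LIMSEQ_I)
    fix e :: real assume "e > 0"
    then obtain M where M: "\<forall>m\<ge>M. \<forall>k\<ge>M. norm (X m - X k) < e / 2"
      using CauchyD[OF X, of "e / 2"] by auto
    have "norm (X m - l1_of_seq a) < e" if "m \<ge> M" for m
      using tail[OF M that] \<open>e > 0\<close> by (simp add: norm_l1_def l1_nth_diff nth)
    then show "\<exists>M. \<forall>m\<ge>M. norm (X m - l1_of_seq a) < e" by blast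
  qed
  then show "convergent X" by (rule convergentI)
qed

lemma
  fixes f g :: "'a::{real_normed_algebra,banach} fps"
  assumes f: "summable (\<lambda>n. norm (fps_nth f n))" and g: "summable (\<lambda>n. norm (fps_nth g n))"
  shows summable_norm_fps_mult: "summable (\<lambda>n. norm (fps_nth (f * g) n))"
    and suminf_norm_fps_mult_le:
      "(\<Sum>n. norm (fps_nth (f * g) n)) \<le> (\<Sum>n. norm (fps_nth f n)) * (\<Sum>n. norm (fps_nth g n))"
proof -
  have prod: "(\<lambda>n. \<Sum>i\<le>n. norm (fps_nth f i) * norm (fps_nth g (n - i))) sums
      ((\<Sum>n. norm (fps_nth f n)) * (\<Sum>n. norm (fps_nth g n)))"
    using f g by (intro Cauchy_product_sums) auto
  have le: "norm (fps_nth (f * g) n) \<le> (\<Sum>i\<le>n. norm (fps_nth f i) * norm (fps_nth g (n - i)))" for n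
    unfolding fps_mult_nth atLeast0AtMost by (intro order_trans[OF norm_sum] sum_mono norm_mult_ineq)
  show s: "summable (\<lambda>n. norm (fps_nth (f * g) n))"
    using le by (intro summable_comparison_test'[OF sums_summable[OF prod], of 0]) simp
  show "(\<Sum>n. norm (fps_nth (f * g) n)) \<le> (\<Sum>n. norm (fps_nth f n)) * (\<Sum>n. norm (fps_nth g n))"
    using sums_le[OF le summable_sums[OF s] prod] .
qed

instantiation l1 :: ("{real_normed_algebra_1, banach}") real_normed_algebra_1
begin

lift_definition one_l1 :: "'a l1" is 1
  by (intro summable_finite[of "{0}"]) (auto simp: fps_one_nth)

lift_definition times_l1 :: "'a l1 \<Rightarrow> 'a l1 \<Rightarrow> 'a l1" is "(*)"
  by (auto intro: summable_norm_fps_mult)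

lemma l1_nth_one: "l1_nth (1 :: 'a l1) n = (if n = 0 then 1 else 0)"
  by transfer (simp add: fps_one_nth)

lemma l1_nth_mult: "l1_nth (f * g :: 'a l1) n = (\<Sum>i\<le>n. l1_nth f i * l1_nth g (n - i))"
  by transfer (simp add: fps_mult_nth atLeast0AtMost)

instance
proof
  fix f g h :: "'a l1" and r :: real
  show "f * g * h = f * (g * h)" "(f + g) * h = f * h + g * h" "f * (g + h) = f * g + f * h"
    "1 * f = f" "f * 1 = f"
    by (transfer; simp add: algebra_simps)+
  show "r *\<^sub>R f * g = r *\<^sub>R (f * g)" "f * r *\<^sub>R g = r *\<^sub>R (f * g)"
    by (simp_all add: l1_eq_iff l1_nth_mult l1_nth_scaleR scaleR_sum_right)
  show "norm (f * g) \<le> norm f * norm g"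
    unfolding norm_l1_def by transfer (auto intro: suminf_norm_fps_mult_le)
  show "norm (1 :: 'a l1) = 1"
    unfolding norm_l1_def l1_nth_one using suminf_finite[of "{0}" "\<lambda>n. norm (if n = 0 then 1 else 0 :: 'a)"]
    by simp
  show "(0 :: 'a l1) \<noteq> 1"
    by (auto simp: l1_eq_iff l1_nth_zero l1_nth_one intro!: exI[of _ 0])
qed

end

text \<open>Splitting off \<open>N\<close> factors at a time gains a factor
  \<open>\<theta> ^ N\<close>, and \<open>C\<close> absorbs the fewer than \<open>N\<close> factors
  left over. No smallness of \<open>norm u\<close> itself is required.\<close>

lemma summable_norm_power:
  fixes u :: "'a::real_normed_algebra_1"
  assumes "N > 0" "norm (u ^ N) < 1"
  shows "summable (\<lambda>n. norm (u ^ n))"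
proof -
  \<comment> \<open>The maximum with 1/2 keeps \<theta> positive even if \<open>u ^ N = 0\<close>,
    since \<open>C\<close> divides by powers of \<theta>.\<close>
  define \<theta> where "\<theta> = root N (max (norm (u ^ N)) (1 / 2))"
  have \<theta>: "0 < \<theta>" "\<theta> < 1" "norm (u ^ N) \<le> \<theta> ^ N"
    using assms by (auto simp: \<theta>_def)
  define C where "C = (\<Sum>r<N. norm (u ^ r) / \<theta> ^ r)"
  have bound: "norm (u ^ n) \<le> C * \<theta> ^ n" for n
  proof (induction n rule: less_induct)
    case (less n)
    show ?case
    proof (cases "n < N")
      case True
      have "norm (u ^ n) / \<theta> ^ n \<le> C"
        unfolding C_def using True \<theta> by (intro member_le_sum) auto
      then show ?thesis using \<theta> by (simp add: divide_simps)
    next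
      case False
      then have "u ^ n = u ^ N * u ^ (n - N)"
        by (simp flip: power_add)
      then have "norm (u ^ n) \<le> norm (u ^ N) * norm (u ^ (n - N))"
        by (simp add: norm_mult_ineq)
      also have "\<dots> \<le> \<theta> ^ N * (C * \<theta> ^ (n - N))"
        using False less \<theta> assms(1) by (intro mult_mono) auto
      also have "\<dots> = C * \<theta> ^ n"
        using False by (simp flip: power_add)
      finally show ?thesis .
    qed
  qed
  have "summable (\<lambda>n. C * \<theta> ^ n)"
    using \<theta> by (intro summable_mult summable_geometric) auto
  then show ?thesis
    by (rule summable_comparison_test'[where N = 0]) (simp add: bound)
qed

section \<open>Evaluation on [-1, 1] and rescaling of the variable\<close>

definition l1_eval :: "'a::real_normed_vector l1 \<Rightarrow> real \<Rightarrow> 'a" where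
  "l1_eval f t = (\<Sum>n. t ^ n *\<^sub>R l1_nth f n)"

lemma norm_l1_eval_term_le: "\<bar>t\<bar> \<le> 1 \<Longrightarrow> norm (t ^ n *\<^sub>R l1_nth f n) \<le> norm (l1_nth f n)"
  by (simp add: power_abs mult_left_le_one_le power_le_one)

lemma summable_norm_l1_eval: "\<bar>t\<bar> \<le> 1 \<Longrightarrow> summable (\<lambda>n. norm (t ^ n *\<^sub>R l1_nth f n))"
  using norm_l1_eval_term_le
  by (intro summable_comparison_test'[OF summable_norm_l1_nth[of f], of 0]) auto

lemma l1_eval_sums:
  fixes f :: "'a::banach l1"
  shows "\<bar>t\<bar> \<le> 1 \<Longrightarrow> (\<lambda>n. t ^ n *\<^sub>R l1_nth f n) sums l1_eval f t"
  unfolding l1_eval_def by (rule summable_sums[OF summable_norm_cancel[OF summable_norm_l1_eval]])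

lemma l1_evalI:
  fixes f :: "'a::banach l1"
  shows "\<bar>t\<bar> \<le> 1 \<Longrightarrow> (\<lambda>n. t ^ n *\<^sub>R l1_nth f n) sums y \<Longrightarrow> l1_eval f t = y"
  using l1_eval_sums sums_unique2 by blast

lemma l1_eval_zero_right: "l1_eval f 0 = l1_nth f 0"
  unfolding l1_eval_def using suminf_finite[of "{0}" "\<lambda>n. 0 ^ n *\<^sub>R l1_nth f n"] by simp

lemma norm_l1_eval_le:
  fixes f :: "'a::banach l1"
  assumes "\<bar>t\<bar> \<le> 1"
  shows "norm (l1_eval f t) \<le> norm f"
  unfolding norm_l1_def
  by (rule norm_sums_le[OF l1_eval_sums[OF assms] summable_sums[OF summable_norm_l1_nth[of f]]
        norm_l1_eval_term_le[OF assms]])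

lemma bounded_linear_l1_eval:
  assumes t: "\<bar>t\<bar> \<le> 1"
  shows "bounded_linear (\<lambda>f :: 'a::banach l1. l1_eval f t)"
proof (rule bounded_linear_intro[where K = 1])
  fix f g :: "'a l1" and r :: real
  show "l1_eval (f + g) t = l1_eval f t + l1_eval g t"
    using sums_add[OF l1_eval_sums[OF t, of f] l1_eval_sums[OF t, of g]]
    by (intro l1_evalI t) (simp add: l1_nth_add scaleR_add_right)
  show "l1_eval (r *\<^sub>R f) t = r *\<^sub>R l1_eval f t"
    using sums_scaleR_right[OF l1_eval_sums[OF t, of f], of r]
    by (intro l1_evalI t) (simp add: l1_nth_scaleR mult.commute)
  show "norm (l1_eval f t) \<le> norm f * 1"
    using norm_l1_eval_le[OF t] by simp
qed

lemma l1_eval_one: "l1_eval 1 t = (1 :: 'a::{real_normed_algebra_1, banach})"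
  unfolding l1_eval_def l1_nth_one
  using suminf_finite[of "{0}" "\<lambda>n. t ^ n *\<^sub>R (if n = 0 then 1 else 0 :: 'a)"] by simp

lemma l1_eval_mult:
  fixes f g :: "'a::{real_normed_algebra_1, banach} l1"
  assumes "\<bar>t\<bar> \<le> 1"
  shows "l1_eval (f * g) t = l1_eval f t * l1_eval g t"
proof (rule l1_evalI[OF assms])
  have "t ^ n *\<^sub>R l1_nth (f * g) n
      = (\<Sum>i\<le>n. (t ^ i *\<^sub>R l1_nth f i) * (t ^ (n - i) *\<^sub>R l1_nth g (n - i)))" for n
    unfolding l1_nth_mult scaleR_sum_right by (intro sum.cong) (auto simp flip: power_add)
  then show "(\<lambda>n. t ^ n *\<^sub>R l1_nth (f * g) n) sums (l1_eval f t * l1_eval g t)"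
    using Cauchy_product_sums[OF summable_norm_l1_eval[OF assms, of f] summable_norm_l1_eval[OF assms, of g]]
    by (simp only: l1_eval_def)
qed

lemma l1_eval_power:
  fixes f :: "'a::{real_normed_algebra_1, banach} l1"
  shows "\<bar>t\<bar> \<le> 1 \<Longrightarrow> l1_eval (f ^ n) t = l1_eval f t ^ n"
  by (induction n) (simp_all add: l1_eval_one l1_eval_mult)

definition l1_dilate :: "real \<Rightarrow> 'a::real_normed_vector l1 \<Rightarrow> 'a l1" where
  "l1_dilate d f = l1_of_seq (\<lambda>n. d ^ n *\<^sub>R l1_nth f n)"

lemma l1_nth_dilate: "\<bar>d\<bar> \<le> 1 \<Longrightarrow> l1_nth (l1_dilate d f) n = d ^ n *\<^sub>R l1_nth f n"
  unfolding l1_dilate_def by (intro l1_nth_of_seq summable_norm_l1_eval)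

lemma l1_eval_dilate: "\<bar>d\<bar> \<le> 1 \<Longrightarrow> l1_eval (l1_dilate d f) t = l1_eval f (d * t)"
  by (simp add: l1_eval_def l1_nth_dilate power_mult_distrib mult.commute)

lemma l1_dilate_power:
  fixes f :: "'a::{real_normed_algebra_1, banach} l1"
  assumes d: "\<bar>d\<bar> \<le> 1"
  shows "l1_dilate d (f ^ n) = l1_dilate d f ^ n"
proof -
  have mult: "l1_dilate d (g * h) = l1_dilate d g * l1_dilate d h" for g h :: "'a l1"
    using d by (auto simp: l1_eq_iff l1_nth_dilate l1_nth_mult scaleR_sum_right
        simp flip: power_add intro!: sum.cong)
  have "l1_dilate d 1 = (1 :: 'a l1)"
    using d by (auto simp: l1_eq_iff l1_nth_dilate l1_nth_one)
  then show ?thesis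
    by (induction n) (simp_all add: mult)
qed

text \<open>Every coefficient but the constant one gains at least one factor \<open>d\<close>. Hence
  a small \<open>d\<close> brings the norm as close to that of the constant coefficient as
  desired.\<close>

lemma norm_l1_dilate_le:
  assumes d: "0 \<le> d" "d \<le> 1"
  shows "norm (l1_dilate d f) \<le> norm (l1_nth f 0) + d * norm f"
proof -
  have "norm (l1_dilate d f) \<le> (\<Sum>n. (if n = 0 then norm (l1_nth f 0) else 0) + d * norm (l1_nth f n))"
    unfolding norm_l1_def
  proof (rule suminf_le)
    show "norm (l1_nth (l1_dilate d f) n)
        \<le> (if n = 0 then norm (l1_nth f 0) else 0) + d * norm (l1_nth f n)" for n
    proof (cases n)
      case (Suc m)
      then have "d ^ n \<le> d" using d by (simp add: mult_left_le power_le_one)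
      then show ?thesis using d Suc by (simp add: l1_nth_dilate power_abs mult_right_mono)
    qed (use d in \<open>simp add: l1_nth_dilate\<close>)
    show "summable (\<lambda>n. (if n = 0 then norm (l1_nth f 0) else 0) + d * norm (l1_nth f n))"
      by (intro summable_add summable_mult summable_norm_l1_nth summable_finite[of "{0}"]) auto
  qed (rule summable_norm_l1_nth)
  also have "\<dots> = (\<Sum>n. if n = 0 then norm (l1_nth f 0) else 0) + (\<Sum>n. d * norm (l1_nth f n))"
    by (intro suminf_add[symmetric] summable_mult summable_norm_l1_nth summable_finite[of "{0}"]) auto
  also have "(\<Sum>n. if n = 0 then norm (l1_nth f 0) else 0) = norm (l1_nth f 0)"
    using suminf_finite[of "{0 :: nat}" "\<lambda>n. if n = 0 then norm (l1_nth f 0) else 0"] by simp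
  also have "(\<Sum>n. d * norm (l1_nth f n)) = d * norm f"
    by (simp add: norm_l1_def suminf_mult summable_norm_l1_nth)
  finally show ?thesis .
qed

text \<open>The radius \<open>s\<close> is scaled to 1, so that functions with different radii of
  convergence are all represented in the same Banach algebra, and shrinking the radius becomes the
  operation \<open>l1_dilate\<close>.\<close>

definition l1_rep :: "(real \<Rightarrow> 'a::real_normed_vector) \<Rightarrow> real \<Rightarrow> real \<Rightarrow> 'a l1 \<Rightarrow> bool" where
  "l1_rep f x\<^sub>0 s F \<longleftrightarrow> s > 0 \<and> (\<forall>t. \<bar>t\<bar> \<le> 1 \<longrightarrow> f (x\<^sub>0 + s * t) = l1_eval F t)"

lemma l1_rep_dilate:
  assumes "l1_rep f x\<^sub>0 s F" "0 < d" "d \<le> 1"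
  shows "l1_rep f x\<^sub>0 (d * s) (l1_dilate d F)"
proof -
  have "f (x\<^sub>0 + d * s * t) = l1_eval F (d * t)" if "\<bar>t\<bar> \<le> 1" for t
    using assms that unfolding l1_rep_def
    by (metis abs_mult abs_of_pos mult.commute mult.left_commute mult_le_one abs_ge_zero)
  then show ?thesis
    using assms by (simp add: l1_rep_def l1_eval_dilate)
qed

lemma has_power_series_at_iff_l1_rep:
  fixes f :: "real \<Rightarrow> 'a::banach"
  shows "has_power_series_at f x\<^sub>0 \<longleftrightarrow> (\<exists>s F. l1_rep f x\<^sub>0 s F)"
proof
  assume "has_power_series_at f x\<^sub>0"
  then obtain a where a: "\<forall>\<^sub>F x in nhds x\<^sub>0. (\<lambda>n. (x - x\<^sub>0) ^ n *\<^sub>R a n) sums f x"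
    unfolding has_power_series_at_def by blast
  then obtain c M where c: "c > 0" "\<And>n. norm (a n) * c ^ n \<le> M"
    by (rule power_series_coeffs_bounded) blast
  obtain e where e: "e > 0" "\<And>x. dist x x\<^sub>0 < e \<Longrightarrow> (\<lambda>n. (x - x\<^sub>0) ^ n *\<^sub>R a n) sums f x"
    using a unfolding eventually_nhds_metric by blast
  define s where "s = min (c / 2) (e / 2)"
  have s: "0 < s" "s < c" "s < e" using c(1) e(1) by (auto simp: s_def)
  define F where "F = l1_of_seq (\<lambda>n. s ^ n *\<^sub>R a n)"
  have "summable (\<lambda>n. norm (s ^ n *\<^sub>R a n))"
    using power_series_coeffs_summable[OF c(2), of s] s by (simp add: mult.commute power_abs)
  then have F: "l1_nth F n = s ^ n *\<^sub>R a n" for n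
    unfolding F_def by (rule l1_nth_of_seq)
  have "l1_eval F t = f (x\<^sub>0 + s * t)" if t: "\<bar>t\<bar> \<le> 1" for t
  proof (rule l1_evalI[OF t])
    have "s * \<bar>t\<bar> < e" using le_less_trans[OF mult_left_le[OF t]] s by simp
    then have "dist (x\<^sub>0 + s * t) x\<^sub>0 < e"
      using s by (simp add: dist_real_def abs_mult)
    from e(2)[OF this] show "(\<lambda>n. t ^ n *\<^sub>R l1_nth F n) sums f (x\<^sub>0 + s * t)"
      by (simp add: F power_mult_distrib mult.commute)
  qed
  then show "\<exists>s F. l1_rep f x\<^sub>0 s F"
    using s unfolding l1_rep_def by metis
next
  assume "\<exists>s F. l1_rep f x\<^sub>0 s F"
  then obtain s F where s: "s > 0" and F: "\<And>t. \<bar>t\<bar> \<le> 1 \<Longrightarrow> f (x\<^sub>0 + s * t) = l1_eval F t"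
    unfolding l1_rep_def by blast
  have "\<forall>\<^sub>F x in nhds x\<^sub>0. \<bar>x - x\<^sub>0\<bar> < s"
    using s by (auto simp: eventually_nhds_metric dist_real_def)
  then have "\<forall>\<^sub>F x in nhds x\<^sub>0. (\<lambda>n. (x - x\<^sub>0) ^ n *\<^sub>R (l1_nth F n /\<^sub>R s ^ n)) sums f x"
  proof eventually_elim
    case (elim x)
    define t where "t = (x - x\<^sub>0) / s"
    have t: "\<bar>t\<bar> \<le> 1" and x: "x\<^sub>0 + s * t = x" using elim s by (auto simp: t_def)
    have "(x - x\<^sub>0) ^ n *\<^sub>R (l1_nth F n /\<^sub>R s ^ n) = t ^ n *\<^sub>R l1_nth F n" for n
      by (simp add: t_def divide_inverse power_mult_distrib power_inverse)
    then show ?case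
      using l1_eval_sums[OF t, of F] F[OF t] by (simp only: x)
  qed
  then show "has_power_series_at f x\<^sub>0"
    unfolding has_power_series_at_def by (rule exI[of _ "\<lambda>n. l1_nth F n /\<^sub>R s ^ n"])
qed

lemma l1_rep_pair:
  assumes "l1_rep f x\<^sub>0 s F" "l1_rep g x\<^sub>0 r G"
  obtains u F' G' where "l1_rep f x\<^sub>0 u F'" "l1_rep g x\<^sub>0 u G'"
proof -
  define u where "u = min s r"
  have pos: "s > 0" "r > 0" using assms by (auto simp: l1_rep_def)
  have "l1_rep f x\<^sub>0 (u / s * s) (l1_dilate (u / s) F)" "l1_rep g x\<^sub>0 (u / r * r) (l1_dilate (u / r) G)"
    using pos by (intro l1_rep_dilate assms; simp add: u_def)+
  then show thesis
    using pos that by simp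
qed

section \<open>Algebraic operations and power series applied to analytic germs\<close>

lemma has_power_series_at_mult:
  fixes f g :: "real \<Rightarrow> 'a::{real_normed_algebra_1, banach}"
  assumes "has_power_series_at f x\<^sub>0" "has_power_series_at g x\<^sub>0"
  shows "has_power_series_at (\<lambda>x. f x * g x) x\<^sub>0"
proof -
  obtain u F G where "l1_rep f x\<^sub>0 u F" "l1_rep g x\<^sub>0 u G"
    using assms l1_rep_pair unfolding has_power_series_at_iff_l1_rep by metis
  then have "l1_rep (\<lambda>x. f x * g x) x\<^sub>0 u (F * G)"
    by (simp add: l1_rep_def l1_eval_mult)
  then show ?thesis
    unfolding has_power_series_at_iff_l1_rep by blast
qed

lemma has_power_series_at_add:
  assumes "has_power_series_at f x\<^sub>0" "has_power_series_at g x\<^sub>0"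
  shows "has_power_series_at (\<lambda>x. f x + g x) x\<^sub>0"
proof -
  obtain a b where "\<forall>\<^sub>F x in nhds x\<^sub>0. (\<lambda>n. (x - x\<^sub>0) ^ n *\<^sub>R a n) sums f x"
    "\<forall>\<^sub>F x in nhds x\<^sub>0. (\<lambda>n. (x - x\<^sub>0) ^ n *\<^sub>R b n) sums g x"
    using assms unfolding has_power_series_at_def by blast
  then have "\<forall>\<^sub>F x in nhds x\<^sub>0. (\<lambda>n. (x - x\<^sub>0) ^ n *\<^sub>R (a n + b n)) sums (f x + g x)"
    by eventually_elim (simp add: scaleR_add_right sums_add)
  then show ?thesis
    unfolding has_power_series_at_def by (rule exI[of _ "\<lambda>n. a n + b n"])
qed

lemma has_power_series_at_bounded_linear:
  assumes "bounded_linear h" "has_power_series_at f x\<^sub>0"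
  shows "has_power_series_at (\<lambda>x. h (f x)) x\<^sub>0"
proof -
  interpret h: bounded_linear h by fact
  obtain a where "\<forall>\<^sub>F x in nhds x\<^sub>0. (\<lambda>n. (x - x\<^sub>0) ^ n *\<^sub>R a n) sums f x"
    using assms unfolding has_power_series_at_def by blast
  then have "\<forall>\<^sub>F x in nhds x\<^sub>0. (\<lambda>n. (x - x\<^sub>0) ^ n *\<^sub>R h (a n)) sums h (f x)"
    by eventually_elim (use h.sums in \<open>fastforce simp: h.scaleR\<close>)
  then show ?thesis
    unfolding has_power_series_at_def by (rule exI[of _ "\<lambda>n. h (a n)"])
qed

lemma has_power_series_at_diff:
  assumes "has_power_series_at f x\<^sub>0" "has_power_series_at g x\<^sub>0"
  shows "has_power_series_at (\<lambda>x. f x - g x) x\<^sub>0"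
  using has_power_series_at_add[OF assms(1)
      has_power_series_at_bounded_linear[OF bounded_linear_minus[OF bounded_linear_ident] assms(2)]]
  by simp

lemma has_power_series_at_const: "has_power_series_at (\<lambda>x. c) x\<^sub>0"
proof -
  have "(\<lambda>n. (x - x\<^sub>0) ^ n *\<^sub>R (if n = 0 then c else 0)) sums c" for x
    using sums_finite[of "{0}" "\<lambda>n. (x - x\<^sub>0) ^ n *\<^sub>R (if n = 0 then c else 0)"] by simp
  then show ?thesis
    unfolding has_power_series_at_def by (intro exI[of _ "\<lambda>n. if n = 0 then c else 0"]) simp
qed

lemma has_power_series_at_sum:
  "(\<And>i. i \<in> I \<Longrightarrow> has_power_series_at (f i) x\<^sub>0) \<Longrightarrow> has_power_series_at (\<lambda>x. \<Sum>i\<in>I. f i x) x\<^sub>0"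
  by (induction I rule: infinite_finite_induct)
    (simp_all add: has_power_series_at_const has_power_series_at_add)

text \<open>Evaluation at a point is a continuous algebra homomorphism, so a series that converges
  for the representing element \<open>u\<close> evaluates to the series of values. After a dilation
  \<open>u ^ N\<close> has norm below 1, because its constant coefficient is
  \<open>f x\<^sub>0 ^ N\<close>.\<close>

lemma has_power_series_at_series:
  fixes f :: "real \<Rightarrow> 'a::{real_normed_algebra_1, banach}" and c :: "nat \<Rightarrow> real"
  assumes c: "\<And>n. \<bar>c n\<bar> \<le> 1" and f: "has_power_series_at f x\<^sub>0"
    and N: "N > 0" "norm (f x\<^sub>0 ^ N) < 1"
  shows "has_power_series_at (\<lambda>x. \<Sum>n. c n *\<^sub>R f x ^ n) x\<^sub>0"
    and "\<forall>\<^sub>F x in nhds x\<^sub>0. summable (\<lambda>n. norm (f x ^ n))"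
proof -
  obtain s F where F: "l1_rep f x\<^sub>0 s F"
    using f unfolding has_power_series_at_iff_l1_rep by blast
  define \<epsilon> where "\<epsilon> = 1 - norm (f x\<^sub>0 ^ N)"
  \<comment> \<open>This \<open>d\<close> lets the non-constant coefficients contribute at most half
    of the gap \<epsilon> between \<open>norm (f x\<^sub>0 ^ N)\<close> and 1; the added 1 avoids
    division by zero.\<close>
  define d where "d = min 1 (\<epsilon> / (2 * (norm (F ^ N) + 1)))"
  have "\<epsilon> > 0" using N by (simp add: \<epsilon>_def)
  then have d: "0 < d" "d \<le> 1" by (auto simp: d_def add_nonneg_pos)
  define u where "u = l1_dilate d F"
  have rep: "l1_rep f x\<^sub>0 (d * s) u"
    unfolding u_def using F d by (rule l1_rep_dilate)
  have "f x\<^sub>0 = l1_eval F 0"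
    using F unfolding l1_rep_def by (metis abs_zero add.right_neutral mult_zero_right zero_le_one)
  then have "l1_nth (F ^ N) 0 = f x\<^sub>0 ^ N"
    by (simp add: l1_eval_power flip: l1_eval_zero_right)
  then have "norm (u ^ N) \<le> (1 - \<epsilon>) + d * norm (F ^ N)"
    using norm_l1_dilate_le[of d "F ^ N"] d by (simp add: u_def l1_dilate_power \<epsilon>_def)
  also have "d * norm (F ^ N) \<le> \<epsilon> / (2 * (norm (F ^ N) + 1)) * (norm (F ^ N) + 1)"
    using d by (intro mult_mono) (auto simp: d_def)
  also have "\<dots> = \<epsilon> / 2"
    using norm_ge_zero[of "F ^ N"] by (simp add: field_simps add_nonneg_eq_0_iff)
  finally have "norm (u ^ N) < 1" using \<open>\<epsilon> > 0\<close> by simp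
  then have u: "summable (\<lambda>n. norm (u ^ n))"
    using N(1) by (rule summable_norm_power[rotated])
  have "norm (c n *\<^sub>R u ^ n) \<le> norm (u ^ n)" for n
    using c[of n] by (simp add: mult_left_le_one_le)
  then have "summable (\<lambda>n. norm (c n *\<^sub>R u ^ n))"
    by (intro summable_comparison_test'[OF u, of 0]) simp
  then have cu: "summable (\<lambda>n. c n *\<^sub>R u ^ n)"
    by (rule summable_norm_cancel)
  have eval: "l1_eval (\<Sum>n. c n *\<^sub>R u ^ n) t = (\<Sum>n. c n *\<^sub>R l1_eval u t ^ n)" if "\<bar>t\<bar> \<le> 1" for t
  proof -
    interpret bounded_linear "\<lambda>f :: 'a l1. l1_eval f t"
      using that by (rule bounded_linear_l1_eval)
    show ?thesis
      using suminf[OF cu] by (simp add: scaleR l1_eval_power that)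
  qed
  have "l1_rep (\<lambda>x. \<Sum>n. c n *\<^sub>R f x ^ n) x\<^sub>0 (d * s) (\<Sum>n. c n *\<^sub>R u ^ n)"
    using rep eval by (simp add: l1_rep_def)
  then show "has_power_series_at (\<lambda>x. \<Sum>n. c n *\<^sub>R f x ^ n) x\<^sub>0"
    unfolding has_power_series_at_iff_l1_rep by blast
  have ds: "d * s > 0" using rep by (simp add: l1_rep_def)
  then have "\<forall>\<^sub>F x in nhds x\<^sub>0. \<bar>x - x\<^sub>0\<bar> < d * s"
    by (auto simp: eventually_nhds_metric dist_real_def)
  then show "\<forall>\<^sub>F x in nhds x\<^sub>0. summable (\<lambda>n. norm (f x ^ n))"
  proof eventually_elim
    case (elim x)
    define t where "t = (x - x\<^sub>0) / (d * s)"
    have t: "\<bar>t\<bar> \<le> 1" "x = x\<^sub>0 + d * s * t" using elim ds by (auto simp: t_def)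
    then have "f x = l1_eval u t" using rep unfolding l1_rep_def by blast
    \<comment> \<open>Evaluation does not increase norms, so the powers of \<open>u\<close> dominate
      those of all nearby values at once.\<close>
    then have "norm (f x ^ n) \<le> norm (u ^ n)" for n
      using norm_l1_eval_le[OF t(1), of "u ^ n"] t(1) by (simp add: l1_eval_power)
    then show ?case
      by (intro summable_comparison_test'[OF u, of 0]) simp
  qed
qed

text \<open>
  Expanding around a nearby point amounts to substituting the series \<open>\<tau> + u X\<close>, of norm at most 1,
  into the given one.
\<close>

lemma eventually_has_power_series_at:
  fixes f :: "real \<Rightarrow> 'a::{real_normed_algebra_1, banach}"
  assumes "has_power_series_at f x\<^sub>0"
  shows "\<forall>\<^sub>F x in nhds x\<^sub>0. has_power_series_at f x"
proof -
  obtain s F where s: "s > 0" and F: "\<And>t. \<bar>t\<bar> \<le> 1 \<Longrightarrow> f (x\<^sub>0 + s * t) = l1_eval F t"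
    using assms unfolding has_power_series_at_iff_l1_rep l1_rep_def by blast
  have "\<forall>\<^sub>F x in nhds x\<^sub>0. \<bar>x - x\<^sub>0\<bar> < s"
    using s by (auto simp: eventually_nhds_metric dist_real_def)
  then show ?thesis
  proof eventually_elim
    case (elim x)
    define \<tau> where "\<tau> = (x - x\<^sub>0) / s"
    \<comment> \<open>The distance from \<tau> to the boundary of [-1, 1]: the largest
      \<open>u\<close> for which \<open>\<tau> + u * t\<close> stays in that interval for all
      \<open>t\<close> in it.\<close>
    define u where "u = 1 - \<bar>\<tau>\<bar>"
    have x: "x = x\<^sub>0 + s * \<tau>" and "u > 0" using elim s by (auto simp: \<tau>_def u_def)
    define C where "C a = l1_of_seq (\<lambda>n. if n = 0 then a else 0)" for a :: 'a
    have C_nth: "l1_nth (C a) n = (if n = 0 then a else 0)" for a n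
      unfolding C_def by (intro l1_nth_of_seq summable_finite[of "{0}"]) auto
    have C_norm: "norm (C a) = norm a" for a
      unfolding norm_l1_def C_nth
      using suminf_finite[of "{0}" "\<lambda>n. norm (if n = 0 then a else 0)"] by simp
    have C_eval: "l1_eval (C a) t = a" for a t
      unfolding l1_eval_def C_nth
      using suminf_finite[of "{0}" "\<lambda>n. t ^ n *\<^sub>R (if n = 0 then a else 0)"] by simp
    define X :: "'a l1" where "X = l1_of_seq (\<lambda>n. if n = 1 then 1 else 0)"
    have X_nth: "l1_nth X n = (if n = 1 then 1 else 0)" for n
      unfolding X_def by (intro l1_nth_of_seq summable_finite[of "{1}"]) auto
    have X_norm: "norm X = 1"
      unfolding norm_l1_def X_nth
      using suminf_finite[of "{1}" "\<lambda>n. norm (if n = 1 then 1 else 0 :: 'a)"] by simp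
    have X_eval: "l1_eval X t = t *\<^sub>R 1" for t
      unfolding l1_eval_def X_nth
      using suminf_finite[of "{1}" "\<lambda>n. t ^ n *\<^sub>R (if n = 1 then 1 else 0 :: 'a)"] by simp
    define y where "y = \<tau> *\<^sub>R 1 + u *\<^sub>R X"
    have "norm y \<le> \<bar>\<tau>\<bar> + u"
      unfolding y_def using norm_triangle_ineq[of "\<tau> *\<^sub>R 1" "u *\<^sub>R X"] \<open>u > 0\<close> by (simp add: X_norm)
    then have "norm y \<le> 1" by (simp add: u_def)
    then have y_power: "norm (y ^ n) \<le> 1" for n
      by (meson norm_ge_zero norm_power_ineq order_trans power_le_one)
    have term_le: "norm (C (l1_nth F n) * y ^ n) \<le> norm (l1_nth F n)" for n
      using norm_mult_ineq[of "C (l1_nth F n)" "y ^ n"] y_power[of n] mult_left_le[of "norm (y ^ n)" "norm (l1_nth F n)"]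
      by (simp add: C_norm)
    have "summable (\<lambda>n. norm (C (l1_nth F n) * y ^ n))"
      by (intro summable_comparison_test'[OF summable_norm_l1_nth[of F], of 0]) (simp add: term_le)
    then have summ: "summable (\<lambda>n. C (l1_nth F n) * y ^ n)"
      by (rule summable_norm_cancel)
    have "l1_eval (\<Sum>n. C (l1_nth F n) * y ^ n) t = l1_eval F (\<tau> + u * t)" if t: "\<bar>t\<bar> \<le> 1" for t
    proof -
      interpret bounded_linear "\<lambda>f :: 'a l1. l1_eval f t"
        using t by (rule bounded_linear_l1_eval)
      have "l1_eval y t = (\<tau> + u * t) *\<^sub>R 1"
        by (simp add: y_def add scaleR l1_eval_one X_eval scaleR_add_left)
      then have "l1_eval (C (l1_nth F n) * y ^ n) t = (\<tau> + u * t) ^ n *\<^sub>R l1_nth F n" for n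
        using t by (simp add: l1_eval_mult l1_eval_power C_eval)
      then show ?thesis
        using suminf[OF summ] by (simp add: l1_eval_def[of F])
    qed
    moreover have "\<bar>\<tau> + u * t\<bar> \<le> 1" if "\<bar>t\<bar> \<le> 1" for t
    proof -
      have "u * \<bar>t\<bar> \<le> u" using \<open>u > 0\<close> that by (simp add: mult_left_le)
      then show ?thesis
        using abs_triangle_ineq[of \<tau> "u * t"] abs_mult[of u t] \<open>u > 0\<close> unfolding u_def by linarith
    qed
    moreover have "x + s * u * t = x\<^sub>0 + s * (\<tau> + u * t)" for t
      by (simp add: x algebra_simps)
    ultimately have "l1_rep f x (s * u) (\<Sum>n. C (l1_nth F n) * y ^ n)"
      using s \<open>u > 0\<close> F unfolding l1_rep_def by simp
    then show ?case
      unfolding has_power_series_at_iff_l1_rep by blast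
  qed
qed

section \<open>Quasinilpotent elements\<close>

lemma scaleC_one: "1 *\<^sub>C x = (x :: 'a::complex_banach_algebra_1)"
  using scaleC_of_real[of 1 x] by simp

lemma scaleC_zero_left: "0 *\<^sub>C x = (0 :: 'a::complex_banach_algebra_1)"
  using scaleC_of_real[of 0 x] by simp

lemma scaleC_minus_left: "(- c) *\<^sub>C x = - (c *\<^sub>C (x :: 'a::complex_banach_algebra_1))"
  using scaleC_add_left[of c "- c" x] by (simp add: scaleC_zero_left eq_neg_iff_add_eq_0 add.commute)

lemma scaleC_diff_left: "(c - d) *\<^sub>C x = c *\<^sub>C x - d *\<^sub>C (x :: 'a::complex_banach_algebra_1)"
  using scaleC_add_left[of c "- d" x] by (simp add: scaleC_minus_left)

lemma scaleC_power: "(c *\<^sub>C x) ^ n = (c ^ n) *\<^sub>C ((x :: 'a::complex_banach_algebra_1) ^ n)"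
  by (induction n) (simp_all add: scaleC_one mult_scaleC_left mult_scaleC_right scaleC_scaleC mult.commute[of _ c])

text \<open>The identity \<open>y = (1 - y) * (u - 1)\<close> is used twice, to get
  \<open>norm (1 - y) \<le> 2\<close> and then the claim. It converts closeness of inverses to 1
  into a bound on powers.\<close>

lemma perturbed_one_norm_le_one:
  fixes y u :: "'a::real_normed_algebra_1"
  assumes "(1 - y) * u = 1" "norm (u - 1) \<le> 1 / 2"
  shows "norm y \<le> 1"
proof -
  have eq: "y = (1 - y) * (u - 1)"
    using assms(1) by (simp add: algebra_simps)
  have "1 - y = 1 - (1 - y) * (u - 1)"
    using eq by simp
  then have "norm (1 - y) \<le> 1 + norm (1 - y) * norm (u - 1)"
    by (metis norm_mult_ineq norm_one norm_triangle_ineq4 order_trans add_left_mono)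
  also have "\<dots> \<le> 1 + norm (1 - y) * (1 / 2)"
    using assms(2) by (intro add_left_mono mult_left_mono) auto
  finally have "norm (1 - y) \<le> 2" by simp
  have "norm y \<le> norm (1 - y) * norm (u - 1)"
    by (metis eq norm_mult_ineq)
  also have "\<dots> \<le> 2 * (1 / 2)"
    using assms(2) \<open>norm (1 - y) \<le> 2\<close> by (intro mult_mono) auto
  finally show ?thesis by simp
qed

text \<open>
  Rickart's elementary substitute for the spectral radius formula: the inverse of \<open>1 - (z x)\<^sup>n\<close> is
  the average of \<open>(1 - \<omega> z x)\<^sup>-\<^sup>1\<close> over the \<open>n\<close>-th roots of unity \<open>\<omega>\<close>, so these inverses are
  equicontinuous in \<open>z\<close>, uniformly in \<open>n\<close>. This propagates \<open>(t x)\<^sup>n \<rightarrow> 0\<close> in small steps from \<open>t = 0\<close>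
  to \<open>t = 1\<close>. With \<open>n = 2\<^sup>k\<close> the average is built by repeated halving.
\<close>

lemma power_two_power_tendsto_zero:
  fixes x :: "'a::complex_banach_algebra_1"
  assumes inv: "\<And>z. \<exists>y. (1 - z *\<^sub>C x) * y = 1 \<and> y * (1 - z *\<^sub>C x) = 1"
  shows "(\<lambda>k. x ^ (2 ^ k)) \<longlonglongrightarrow> 0"
proof -
  obtain R where R: "\<And>z. (1 - z *\<^sub>C x) * R z = 1" "\<And>z. R z * (1 - z *\<^sub>C x) = 1"
    using inv by metis
  have resolvent: "R z - R w = (z - w) *\<^sub>C (R z * x * R w)" for z w
  proof -
    have "R z - R w = R z * ((1 - w *\<^sub>C x) * R w) - (R z * (1 - z *\<^sub>C x)) * R w"
      by (simp add: R)
    also have "\<dots> = R z * (z *\<^sub>C x - w *\<^sub>C x) * R w"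
      by (simp add: algebra_simps)
    finally show ?thesis
      by (simp add: mult_scaleC_left mult_scaleC_right flip: scaleC_diff_left)
  qed
  have normR: "norm (R z - R w) \<le> dist z w * norm (R z) * (norm x * norm (R w))" for z w
  proof -
    have "norm (R z * x * R w) \<le> norm (R z) * norm x * norm (R w)"
      by (meson mult_right_mono norm_ge_zero norm_mult_ineq order_trans)
    then show ?thesis
      by (simp add: resolvent norm_scaleC dist_norm mult.assoc mult_left_mono)
  qed
  have "isCont R w" for w
  proof -
    define C where "C = norm x * norm (R w) + 1"
    have "C > 0" by (simp add: C_def add_nonneg_pos)
    have near: "\<forall>\<^sub>F z in at w. dist z w * C < 1 / 2"
    proof -
      have "((\<lambda>z. dist z w * C) \<longlongrightarrow> dist w w * C) (at w)"
        by (intro tendsto_intros)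
      then show ?thesis
        by (intro order_tendstoD(2)[of _ "dist w w * C"]) auto
    qed
    \<comment> \<open>For \<open>z\<close> this close to \<open>w\<close>, the resolvent identity
      can be absorbed to give \<open>norm (R z) \<le> 2 * norm (R w)\<close>; inserted into the same
      identity, this is a Lipschitz estimate at \<open>w\<close>.\<close>
    have bound: "norm (R z - R w) \<le> dist z w * (2 * norm (R w) * C)" if "dist z w * C < 1 / 2" for z
    proof -
      have *: "norm (R z - R w) \<le> dist z w * C * norm (R z)"
      proof -
        have "norm (R z - R w) \<le> dist z w * norm (R z) * (norm x * norm (R w))"
          by (rule normR)
        also have "\<dots> \<le> dist z w * norm (R z) * C"
          unfolding C_def by (intro mult_left_mono) auto
        finally show ?thesis by (simp add: mult_ac)
      qed
      also have "\<dots> \<le> 1 / 2 * norm (R z)"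
        using that by (intro mult_right_mono) auto
      finally have "norm (R z) \<le> 2 * norm (R w)"
        using norm_triangle_sub[of "R z" "R w"] by simp
      then have "dist z w * C * norm (R z) \<le> dist z w * C * (2 * norm (R w))"
        using \<open>C > 0\<close> by (intro mult_left_mono) auto
      with * show ?thesis by (simp add: mult_ac)
    qed
    have "((\<lambda>z. R z - R w) \<longlongrightarrow> 0) (at w)"
    proof (rule Lim_null_comparison)
      show "\<forall>\<^sub>F z in at w. norm (R z - R w) \<le> dist z w * (2 * norm (R w) * C)"
        using near bound by (auto elim: eventually_mono)
      show "((\<lambda>z. dist z w * (2 * norm (R w) * C)) \<longlongrightarrow> 0) (at w)"
        by (intro tendsto_mult_left_zero) (simp add: tendsto_dist_iff[symmetric])
    qed
    then show ?thesis
      by (simp add: isCont_def LIM_zero_iff)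
  qed
  \<comment> \<open>Radius 2 rather than 1, because the stepping argument below looks one step past
    its target and so may pass 1. The disc is also invariant under rotation by roots of
    unity.\<close>
  then have contR: "continuous_on (cball 0 2) R"
    by (simp add: continuous_at_imp_continuous_on)
  then have "bounded (R ` cball 0 2)"
    by (intro compact_imp_bounded compact_continuous_image) auto
  then obtain M where "\<forall>y\<in>R ` cball 0 2. norm y \<le> M"
    unfolding bounded_iff by blast
  then have M: "\<And>z. cmod z \<le> 2 \<Longrightarrow> norm (R z) \<le> M"
    by simp
  have "uniformly_continuous_on (cball 0 2) R"
    using contR by (intro compact_uniformly_continuous) auto
  then have "\<exists>\<delta>>0. \<forall>w\<in>cball 0 2. \<forall>z\<in>cball 0 2. dist z w < \<delta> \<longrightarrow> dist (R z) (R w) < 1 / 4"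
    unfolding uniformly_continuous_on_def by (rule allE[of _ "1 / 4"]) simp
  then obtain \<delta> where \<delta>: "\<delta> > 0"
    "\<And>z w. cmod z \<le> 2 \<Longrightarrow> cmod w \<le> 2 \<Longrightarrow> dist z w < \<delta> \<Longrightarrow> norm (R z - R w) < 1 / 4"
    by (auto simp: dist_norm)
  \<comment> \<open>What matters is that \<open>M\<close>, \<delta> and 1/4 do not depend on
    \<open>k\<close>: averaging two functions with these bounds preserves them.\<close>
  have U: "\<exists>U. (\<forall>z. (1 - (z *\<^sub>C x) ^ (2 ^ k)) * U z = 1) \<and>
      (\<forall>z. cmod z \<le> 2 \<longrightarrow> norm (U z) \<le> M) \<and>
      (\<forall>z w. cmod z \<le> 2 \<longrightarrow> cmod w \<le> 2 \<longrightarrow> dist z w < \<delta> \<longrightarrow> norm (U z - U w) \<le> 1 / 4)" for k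
  proof (induction k)
    case 0
    show ?case
      using R M \<delta>(2) by (intro exI[of _ R]) (auto intro: less_imp_le)
  next
    case (Suc k)
    then obtain U where U1: "\<And>z. (1 - (z *\<^sub>C x) ^ (2 ^ k)) * U z = 1"
      and U2: "\<And>z. cmod z \<le> 2 \<Longrightarrow> norm (U z) \<le> M"
      and U3: "\<And>z w. cmod z \<le> 2 \<Longrightarrow> cmod w \<le> 2 \<Longrightarrow> dist z w < \<delta> \<Longrightarrow> norm (U z - U w) \<le> 1 / 4"
      by blast
    \<comment> \<open>Rotation by this \<omega> changes the sign of
      \<open>(z *\<^sub>C x) ^ (2 ^ k)\<close>. Halving is then the partial fraction identity that
      averages the inverses of \<open>1 - y\<close> and \<open>1 + y\<close> to that of
      \<open>1 - y * y\<close>.\<close>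
    define \<omega> where "\<omega> = cis (pi / 2 ^ k)"
    have \<omega>: "\<omega> ^ (2 ^ k) = -1" "cmod \<omega> = 1"
      using Complex.DeMoivre[of "pi / 2 ^ k" "2 ^ k"] by (simp_all add: \<omega>_def)
    define V where "V z = (1 / 2) *\<^sub>R (U z + U (\<omega> * z))" for z
    show ?case
    proof (intro exI[of _ V] conjI allI impI)
      fix z
      define y where "y = (z *\<^sub>C x) ^ (2 ^ k)"
      have "((\<omega> * z) *\<^sub>C x) ^ (2 ^ k) = - y"
        by (simp add: y_def scaleC_power power_mult_distrib \<omega> scaleC_minus_left)
      then have y: "(1 - y) * U z = 1" "(1 + y) * U (\<omega> * z) = 1"
        using U1[of z] U1[of "\<omega> * z"] by (simp_all add: y_def)
      have "(1 - y * y) * (U z + U (\<omega> * z)) = (1 + y) * ((1 - y) * U z) + (1 - y) * ((1 + y) * U (\<omega> * z))"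
        by (simp add: algebra_simps)
      also have "\<dots> = (1 + y) + (1 - y)" by (simp add: y)
      also have "\<dots> = 2 *\<^sub>R 1" by (simp add: scaleR_2)
      finally have "(1 - y * y) * V z = 1" by (simp add: V_def)
      then show "(1 - (z *\<^sub>C x) ^ (2 ^ Suc k)) * V z = 1"
        by (simp add: y_def mult_2 flip: power_add)
    next
      fix z :: complex assume z: "cmod z \<le> 2"
      then have "cmod (\<omega> * z) \<le> 2" by (simp add: norm_mult \<omega>)
      then show "norm (V z) \<le> M"
        using U2[OF z] U2[of "\<omega> * z"] norm_triangle_ineq[of "U z" "U (\<omega> * z)"] by (simp add: V_def)
    next
      fix z w :: complex assume zw: "cmod z \<le> 2" "cmod w \<le> 2" "dist z w < \<delta>"
      then have "cmod (\<omega> * z) \<le> 2" "cmod (\<omega> * w) \<le> 2" by (simp_all add: norm_mult \<omega>)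
      moreover have "dist (\<omega> * z) (\<omega> * w) < \<delta>"
        using zw(3) by (simp add: dist_norm norm_mult \<omega> flip: right_diff_distrib)
      ultimately have "norm (U (\<omega> * z) - U (\<omega> * w)) \<le> 1 / 4" by (rule U3)
      moreover have "norm (U z - U w) \<le> 1 / 4" using zw by (rule U3)
      moreover have "V z - V w = (1 / 2) *\<^sub>R ((U z - U w) + (U (\<omega> * z) - U (\<omega> * w)))"
        by (simp add: V_def algebra_simps)
      moreover have "norm ((U z - U w) + (U (\<omega> * z) - U (\<omega> * w))) \<le> norm (U z - U w) + norm (U (\<omega> * z) - U (\<omega> * w))"
        by (rule norm_triangle_ineq)
      ultimately show "norm (V z - V w) \<le> 1 / 4" by simp
    qed
  qed
  \<comment> \<open>The mesh is chosen so that two steps, from \<open>j\<close> to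
    \<open>j + 2\<close>, remain within \<delta>.\<close>
  obtain m :: nat where m: "m \<ge> 1" "2 / real m < \<delta>"
  proof -
    obtain m :: nat where "real m > 2 / \<delta>" using reals_Archimedean2 by blast
    moreover then have "m \<ge> 1" using \<delta>(1) by (cases m) (auto simp: field_simps)
    ultimately show thesis using that[of m] \<delta>(1) by (simp add: field_simps)
  qed
  have "(\<lambda>k. norm (((real j / real m) *\<^sub>R x) ^ (2 ^ k))) \<longlonglongrightarrow> 0" if "j \<le> m" for j
    using that
  proof (induction j)
    case 0
    show ?case by (simp add: power_0_left)
  next
    case (Suc j)
    define t where "t = real j / real m"
    define t' where "t' = real (Suc j) / real m"
    \<comment> \<open>One step beyond the target \<open>t'\<close>. At \<open>s\<close> the powers
      are only shown to be bounded; the ratio \<open>t' / s < 1\<close> turns this into convergence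
      to 0 at \<open>t'\<close>.\<close>
    define s where "s = real (j + 2) / real m"
    have ts: "0 \<le> t" "t \<le> 2" "0 < t'" "t' < s" "s \<le> 2" "\<bar>s - t\<bar> < \<delta>"
      using Suc.prems m by (auto simp: t_def t'_def s_def divide_simps)
    have scal: "complex_of_real u *\<^sub>C x = u *\<^sub>R x" for u by (rule scaleC_of_real)
    have lim: "(\<lambda>k. norm ((t *\<^sub>R x) ^ (2 ^ k)) * M) \<longlonglongrightarrow> 0"
      using Suc by (intro tendsto_mult_left_zero) (simp add: t_def)
    then have "\<forall>\<^sub>F k in sequentially. norm ((t *\<^sub>R x) ^ (2 ^ k)) * M < 1 / 4"
      by (rule order_tendstoD) simp
    \<comment> \<open>Eventually \<open>U t\<close> is within 1/4 of 1; equicontinuity costs another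
      1/4 at \<open>s\<close>, and 1/2 is what \<open>perturbed_one_norm_le_one\<close>
      allows.\<close>
    then have bdd: "\<forall>\<^sub>F k in sequentially. norm ((s *\<^sub>R x) ^ (2 ^ k)) \<le> 1"
    proof eventually_elim
      case (elim k)
      obtain U where U1: "\<And>z. (1 - (z *\<^sub>C x) ^ (2 ^ k)) * U z = 1"
        and U2: "\<And>z. cmod z \<le> 2 \<Longrightarrow> norm (U z) \<le> M"
        and U3: "\<And>z w. cmod z \<le> 2 \<Longrightarrow> cmod w \<le> 2 \<Longrightarrow> dist z w < \<delta> \<Longrightarrow> norm (U z - U w) \<le> 1 / 4"
        using U by blast
      have "U t - 1 = (t *\<^sub>R x) ^ (2 ^ k) * U t"
        using U1[of t] by (simp add: scal algebra_simps)
      then have "norm (U t - 1) \<le> norm ((t *\<^sub>R x) ^ (2 ^ k)) * norm (U t)"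
        by (metis norm_mult_ineq)
      also have "\<dots> \<le> norm ((t *\<^sub>R x) ^ (2 ^ k)) * M"
        using ts by (intro mult_left_mono U2) auto
      finally have "norm (U t - 1) < 1 / 4" using elim by simp
      moreover have "norm (U s - U t) \<le> 1 / 4"
        using ts by (intro U3) (auto simp: dist_norm simp flip: of_real_diff)
      moreover have "norm (U s - 1) \<le> norm (U s - U t) + norm (U t - 1)"
        by (metis diff_add_cancel add_diff_eq norm_triangle_ineq)
      ultimately have "norm (U s - 1) \<le> 1 / 2" by simp
      moreover have "(1 - (s *\<^sub>R x) ^ (2 ^ k)) * U s = 1"
        using U1[of s] by (simp only: scal)
      ultimately show ?case
        by (intro perturbed_one_norm_le_one)
    qed
    have *: "norm ((t' *\<^sub>R x) ^ (2 ^ k)) = (t' / s) ^ (2 ^ k) * norm ((s *\<^sub>R x) ^ (2 ^ k))" for k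
    proof -
      have "t' *\<^sub>R x = (t' / s) *\<^sub>R (s *\<^sub>R x)" using ts by simp
      then have "(t' *\<^sub>R x) ^ (2 ^ k) = (t' / s) ^ (2 ^ k) *\<^sub>R (s *\<^sub>R x) ^ (2 ^ k)"
        by (simp only: scaleR_power)
      then show ?thesis using ts by (simp only: norm_scaleR) simp
    qed
    have pow: "(\<lambda>k. (t' / s) ^ (2 ^ k)) \<longlonglongrightarrow> 0"
    proof -
      have "filterlim (\<lambda>k. 2 ^ k :: nat) at_top sequentially"
        by (rule filterlim_subseq) (simp add: strict_mono_def)
      then show ?thesis
        using ts by (intro filterlim_compose[OF LIMSEQ_power_zero]) auto
    qed
    have "(\<lambda>k. norm ((t' *\<^sub>R x) ^ (2 ^ k))) \<longlonglongrightarrow> 0"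
    proof (rule Lim_null_comparison[OF _ pow])
      show "\<forall>\<^sub>F k in sequentially. norm (norm ((t' *\<^sub>R x) ^ (2 ^ k))) \<le> (t' / s) ^ (2 ^ k)"
        using bdd
      proof eventually_elim
        case (elim k)
        have "norm ((t' *\<^sub>R x) ^ (2 ^ k)) \<le> (t' / s) ^ (2 ^ k) * 1"
          unfolding * using ts elim by (intro mult_left_mono) auto
        then show ?case
          by (simp only: real_norm_def abs_norm_cancel mult_1_right)
      qed
    qed
    then show ?case by (simp add: t'_def)
  qed
  from this[of m] m have "(\<lambda>k. norm (x ^ (2 ^ k))) \<longlonglongrightarrow> 0" by simp
  then show ?thesis by (simp add: tendsto_norm_zero_iff)
qed

text \<open>For nonzero \<open>w\<close>, \<open>1 - w x\<close> is \<open>w\<close> times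
  \<open>1/w - x\<close>, and \<open>1/w\<close> is outside the spectrum. So all
  \<open>1 - w x\<close> are invertible, and the factor \<open>c\<close> is absorbed into
  \<open>w\<close>.\<close>

lemma quasinilpotent_scaled_power_norm_less:
  fixes x :: "'a::complex_banach_algebra_1"
  assumes "spectrum x \<subseteq> {0}" "e > 0"
  obtains N where "N > 0" "norm ((c *\<^sub>R x) ^ N) < e"
proof -
  have "\<exists>y. (1 - z *\<^sub>C (c *\<^sub>R x)) * y = 1 \<and> y * (1 - z *\<^sub>C (c *\<^sub>R x)) = 1" for z
  proof (cases "z * of_real c = 0")
    case True
    then have "z *\<^sub>C (c *\<^sub>R x) = 0"
      by (metis scaleC_of_real scaleC_scaleC scaleC_zero_left)
    then show ?thesis by (intro exI[of _ 1]) simp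
  next
    case False
    define w where "w = z * of_real c"
    have "w \<noteq> 0" using False by (simp add: w_def)
    have zc: "z *\<^sub>C (c *\<^sub>R x) = w *\<^sub>C x"
      by (simp add: w_def flip: scaleC_of_real scaleC_scaleC)
    have "inverse w \<notin> spectrum x" using assms \<open>w \<noteq> 0\<close> by auto
    then obtain y where y: "(inverse w *\<^sub>C 1 - x) * y = 1" "y * (inverse w *\<^sub>C 1 - x) = 1"
      unfolding spectrum_def by auto
    have fac: "1 - w *\<^sub>C x = w *\<^sub>C (inverse w *\<^sub>C 1 - x)"
      using \<open>w \<noteq> 0\<close> scaleC_add_right[of w "inverse w *\<^sub>C 1 - x" x]
      by (simp add: scaleC_scaleC scaleC_one algebra_simps)
    show ?thesis
      using y \<open>w \<noteq> 0\<close>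
      by (intro exI[of _ "inverse w *\<^sub>C y"])
        (simp add: zc fac mult_scaleC_left mult_scaleC_right scaleC_scaleC scaleC_one)
  qed
  then have "(\<lambda>k. norm ((c *\<^sub>R x) ^ (2 ^ k))) \<longlonglongrightarrow> 0"
    using power_two_power_tendsto_zero tendsto_norm_zero by blast
  then have "\<forall>\<^sub>F k in sequentially. norm ((c *\<^sub>R x) ^ (2 ^ k)) < e"
    using \<open>e > 0\<close> by (rule order_tendstoD)
  then obtain k where "norm ((c *\<^sub>R x) ^ (2 ^ k)) < e"
    using eventually_happens'[OF sequentially_bot] by blast
  then show thesis
    using that[of "2 ^ k"] by simp
qed

section \<open>Idempotents from near-idempotents\<close>

text \<open>Consecutive coefficients have ratio \<open>(- 1/2 - n) / (n + 1)\<close>, of absolute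
  value at most 1.\<close>

lemma abs_gbinomial_minus_half_le: "\<bar>(- (1 / 2) :: real) gchoose n\<bar> \<le> 1"
proof (induction n)
  case (Suc n)
  have "(- (1 / 2) :: real) gchoose Suc n = (- (1 / 2) gchoose n) * ((- (1 / 2) - real n) / (real n + 1))"
    by (simp add: gbinomial_prod_rev field_simps)
  moreover have "\<bar>(- (1 / 2) - real n) / (real n + 1)\<bar> \<le> 1"
    by (simp add: abs_if field_simps)
  ultimately show ?case
    using mult_le_one[OF Suc abs_ge_zero] by (simp only: abs_mult)
qed simp

text \<open>The coefficient form of the formal identity saying that \<open>(1 + X)\<close> to the
  power -1/2, squared, is \<open>1 / (1 + X)\<close>.\<close>

lemma gbinomial_minus_half_convolution:
  "(\<Sum>i\<le>n. (- (1 / 2) gchoose i) * (- (1 / 2) gchoose (n - i))) = (- 1 :: real) ^ n"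
proof -
  have "(- 1 :: real) gchoose n = (- 1) ^ n"
  proof (induction n)
    case (Suc n)
    have "(- 1 :: real) gchoose Suc n = (- 1 gchoose n) * ((- 1 - real n) / (real n + 1))"
      by (simp add: gbinomial_prod_rev field_simps)
    also have "(- 1 - real n) / (real n + 1) = - 1"
      by (simp add: field_simps)
    finally show ?case using Suc by simp
  qed simp
  moreover have "fps_nth (fps_binomial (- (1 / 2) + - (1 / 2) :: real)) n
      = fps_nth (fps_binomial (- (1 / 2)) * fps_binomial (- (1 / 2))) n"
    by (simp only: fps_binomial_add_mult)
  ultimately show ?thesis
    by (simp add: fps_mult_nth atLeast0AtMost)
qed

definition inv_sqrt_series :: "'a::{real_normed_algebra_1, banach} \<Rightarrow> 'a" where
  "inv_sqrt_series y = (\<Sum>n. (- (1 / 2) gchoose n :: real) *\<^sub>R y ^ n)"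

lemma inv_sqrt_series_summable:
  fixes y :: "'a::{real_normed_algebra_1, banach}"
  assumes "summable (\<lambda>n. norm (y ^ n))"
  shows "summable (\<lambda>n. norm ((- (1 / 2) gchoose n :: real) *\<^sub>R y ^ n))"
  by (rule summable_comparison_test'[OF assms, of 0])
    (simp add: mult_left_le_one_le abs_gbinomial_minus_half_le)

lemma inv_sqrt_series_linear_image:
  fixes y :: "'a::{real_normed_algebra_1, banach}" and T :: "'a \<Rightarrow> 'b::{real_normed_algebra_1, banach}"
  assumes "summable (\<lambda>n. norm (y ^ n))" "bounded_linear T"
  shows "T (inv_sqrt_series y) = (\<Sum>n. (- (1 / 2) gchoose n :: real) *\<^sub>R T (y ^ n))"
proof -
  interpret T: bounded_linear T by fact
  show ?thesis
    unfolding inv_sqrt_series_def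
    using T.suminf[OF summable_norm_cancel[OF inv_sqrt_series_summable[OF assms(1)]]]
    by (simp add: T.scaleR)
qed

text \<open>Stated for linear \<open>T\<close>, with the vanishing assumed on powers, so as to cover
  homomorphisms that kill \<open>y\<close> and also left and right multiplication by an element
  annihilating \<open>y\<close>.\<close>

lemma inv_sqrt_series_collapse:
  fixes y :: "'a::{real_normed_algebra_1, banach}" and T :: "'a \<Rightarrow> 'b::{real_normed_algebra_1, banach}"
  assumes "summable (\<lambda>n. norm (y ^ n))" "bounded_linear T" "\<And>n. n > 0 \<Longrightarrow> T (y ^ n) = 0"
  shows "T (inv_sqrt_series y) = T 1"
proof -
  have "(\<Sum>n. (- (1 / 2) gchoose n :: real) *\<^sub>R T (y ^ n))
      = (\<Sum>n\<in>{0}. (- (1 / 2) gchoose n :: real) *\<^sub>R T (y ^ n))"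
    by (rule suminf_finite) (auto simp: assms(3))
  then show ?thesis
    using inv_sqrt_series_linear_image[OF assms(1,2)] by simp
qed

lemma inv_sqrt_series_commute:
  fixes y z :: "'a::{real_normed_algebra_1, banach}"
  assumes "summable (\<lambda>n. norm (y ^ n))" "z * y = y * z"
  shows "z * inv_sqrt_series y = inv_sqrt_series y * z"
proof -
  have "z * y ^ n = y ^ n * z" for n
    using assms(2) by (metis power_commuting_commutes)
  then show ?thesis
    using inv_sqrt_series_linear_image[OF assms(1) bounded_linear_mult_right[of z]]
      inv_sqrt_series_linear_image[OF assms(1) bounded_linear_mult_left[of z]]
    by simp
qed

text \<open>The Cauchy square of the series is the Neumann series of \<open>1 / (1 + y)\<close>,
  which telescopes against \<open>1 + y\<close>.\<close>

lemma inv_sqrt_series_square: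
  fixes y :: "'a::{real_normed_algebra_1, banach}"
  assumes y: "summable (\<lambda>n. norm (y ^ n))"
  shows "inv_sqrt_series y * inv_sqrt_series y * (1 + y) = 1"
proof -
  define c where "c n = (- (1 / 2) gchoose n :: real)" for n
  have "norm ((- y) ^ n) = norm (y ^ n)" for n
    using power_minus[of y n] by (cases "even n") auto
  then have s: "summable (\<lambda>n. (- y) ^ n)"
    using y by (auto intro!: summable_norm_cancel[of "\<lambda>n. (- y) ^ n"])
  have "inv_sqrt_series y * inv_sqrt_series y = (\<Sum>n. \<Sum>i\<le>n. (c i *\<^sub>R y ^ i) * (c (n - i) *\<^sub>R y ^ (n - i)))"
    unfolding inv_sqrt_series_def c_def using inv_sqrt_series_summable[OF y]
    by (intro Cauchy_product)
  also have "\<dots> = (\<Sum>n. (- y) ^ n)"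
  proof (rule suminf_cong)
    fix n
    have "(\<Sum>i\<le>n. (c i *\<^sub>R y ^ i) * (c (n - i) *\<^sub>R y ^ (n - i))) = (\<Sum>i\<le>n. (c i * c (n - i)) *\<^sub>R y ^ n)"
      by (intro sum.cong) (auto simp: mult.commute simp flip: power_add)
    also have "\<dots> = (- 1) ^ n *\<^sub>R y ^ n"
      using gbinomial_minus_half_convolution[of n] by (simp add: c_def flip: scaleR_sum_left)
    also have "\<dots> = (- y) ^ n"
      using scaleR_power[of "-1" y n] by simp
    finally show "(\<Sum>i\<le>n. (c i *\<^sub>R y ^ i) * (c (n - i) *\<^sub>R y ^ (n - i))) = (- y) ^ n" .
  qed
  finally have "inv_sqrt_series y * inv_sqrt_series y * (1 + y) = (\<Sum>n. (- y) ^ n * (1 + y))"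
    using suminf_mult2[OF s, of "1 + y"] by simp
  also have "\<dots> = (\<Sum>n. (- y) ^ n - (- y) ^ Suc n)"
    by (simp add: distrib_left power_Suc2 del: power_Suc)
  also have "\<dots> = 1"
    using telescope_sums'[OF summable_LIMSEQ_zero[OF s]] by (simp add: sums_iff)
  finally show ?thesis .
qed

text \<open>
  Since \<open>(2x - 1)\<^sup>2 = 1 + 4(x\<^sup>2 - x)\<close>, the element \<open>idempotent_of x\<close> is
  \<open>(1 + sgn (2x - 1)) / 2\<close>, the spectral projection of \<open>x\<close> near 1.
\<close>

definition idempotent_of :: "'a::{real_normed_algebra_1, banach} \<Rightarrow> 'a" where
  "idempotent_of x = (1 / 2) *\<^sub>R 1 + (x - (1 / 2) *\<^sub>R 1) * inv_sqrt_series (4 *\<^sub>R (x * x - x))"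

context
  fixes x :: "'a::{real_normed_algebra_1, banach}"
  assumes summ: "summable (\<lambda>n. norm ((4 *\<^sub>R (x * x - x)) ^ n))"
begin

lemma idempotent_of_commute:
  "(x - (1 / 2) *\<^sub>R 1) * inv_sqrt_series (4 *\<^sub>R (x * x - x))
    = inv_sqrt_series (4 *\<^sub>R (x * x - x)) * (x - (1 / 2) *\<^sub>R 1)"
  by (intro inv_sqrt_series_commute summ) (simp add: algebra_simps)

text \<open>With \<open>v = x - 1/2\<close>, the product \<open>v * S\<close> has square 1/4, and
  adding 1/2 to such an element gives an idempotent.\<close>

lemma idempotent_of_idempotent: "idempotent_of x * idempotent_of x = idempotent_of x"
proof -
  define y where "y = 4 *\<^sub>R (x * x - x)"
  define S where "S = inv_sqrt_series y"
  define v where "v = x - (1 / 2) *\<^sub>R 1"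
  have comm: "v * S = S * v"
    using idempotent_of_commute by (simp add: v_def S_def y_def)
  have vv: "4 *\<^sub>R (v * v) = 1 + y"
    by (simp add: v_def y_def algebra_simps flip: scaleR_add_left)
  have "4 *\<^sub>R ((v * S) * (v * S)) = S * S * (4 *\<^sub>R (v * v))"
    by (metis comm mult.assoc mult_scaleR_right)
  also have "\<dots> = 1"
    unfolding vv using inv_sqrt_series_square[OF summ] by (simp add: S_def y_def)
  finally have "(1 / 4) *\<^sub>R 4 *\<^sub>R ((v * S) * (v * S)) = (1 / 4 :: real) *\<^sub>R 1"
    by (rule arg_cong)
  then have "(v * S) * (v * S) = (1 / 4) *\<^sub>R 1" by simp
  then have "((1 / 2) *\<^sub>R 1 + v * S) * ((1 / 2) *\<^sub>R 1 + v * S)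
      = ((1 / 4) *\<^sub>R 1 + (1 / 4) *\<^sub>R 1) + ((1 / 2) *\<^sub>R (v * S) + (1 / 2) *\<^sub>R (v * S))"
    by (simp add: distrib_left distrib_right scaleR_add_right)
  also have "\<dots> = (1 / 2) *\<^sub>R 1 + v * S"
    by (simp flip: scaleR_add_left)
  finally have "((1 / 2) *\<^sub>R 1 + v * S) * ((1 / 2) *\<^sub>R 1 + v * S) = (1 / 2) *\<^sub>R 1 + v * S" .
  then show ?thesis
    by (simp add: idempotent_of_def v_def S_def y_def)
qed

text \<open>Multiplication by \<open>z\<close> reduces the inverse square root to its constant term
  1, after which the two halves of \<open>z\<close> cancel.\<close>

lemma idempotent_of_annihilated_left:
  assumes "z * x = 0"
  shows "z * idempotent_of x = 0"
proof -
  have "z * (4 *\<^sub>R (x * x - x)) ^ n = 0" if n: "n > 0" for n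
  proof -
    have "z * (4 *\<^sub>R (x * x - x)) = 4 *\<^sub>R ((z * x) * x - z * x)"
      by (simp only: mult_scaleR_right right_diff_distrib mult.assoc)
    then have "z * (4 *\<^sub>R (x * x - x)) = 0" by (simp add: assms)
    moreover obtain m where "n = Suc m" using n by (cases n) auto
    ultimately show ?thesis by (simp flip: mult.assoc)
  qed
  then have S: "z * inv_sqrt_series (4 *\<^sub>R (x * x - x)) = z"
    using inv_sqrt_series_collapse[OF summ bounded_linear_mult_right[of z]] by simp
  have "z * idempotent_of x = (1 / 2) *\<^sub>R z
      + (z * x - (1 / 2) *\<^sub>R z) * inv_sqrt_series (4 *\<^sub>R (x * x - x))"
    by (simp add: idempotent_of_def algebra_simps)
  then show ?thesis
    by (simp add: assms S)
qed

lemma idempotent_of_annihilated_right: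
  assumes "x * z = 0"
  shows "idempotent_of x * z = 0"
proof -
  have "(4 *\<^sub>R (x * x - x)) ^ n * z = 0" if n: "n > 0" for n
  proof -
    have "(4 *\<^sub>R (x * x - x)) * z = 4 *\<^sub>R (x * (x * z) - x * z)"
      by (simp only: mult_scaleR_left left_diff_distrib mult.assoc)
    then have "(4 *\<^sub>R (x * x - x)) * z = 0" by (simp add: assms)
    moreover obtain m where "n = Suc m" using n by (cases n) auto
    ultimately show ?thesis by (simp only: power_Suc2 mult.assoc mult_zero_right)
  qed
  then have S: "inv_sqrt_series (4 *\<^sub>R (x * x - x)) * z = z"
    using inv_sqrt_series_collapse[OF summ bounded_linear_mult_left[of z]] by simp
  have "idempotent_of x * z = (1 / 2) *\<^sub>R z
      + inv_sqrt_series (4 *\<^sub>R (x * x - x)) * (x * z - (1 / 2) *\<^sub>R z)"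
    unfolding idempotent_of_def idempotent_of_commute by (simp add: algebra_simps)
  then show ?thesis
    by (simp add: assms S)
qed

lemma idempotent_of_hom:
  fixes T :: "'a \<Rightarrow> 'b::{real_normed_algebra_1, banach}"
  assumes "bounded_linear T" and mult: "\<And>a b. T (a * b) = T a * T b" and "T 1 = 1"
    and idem: "T x * T x = T x"
  shows "T (idempotent_of x) = T x"
proof -
  interpret T: bounded_linear T by fact
  have zero: "T (4 *\<^sub>R (x * x - x)) = 0"
    by (simp add: T.scaleR T.diff mult idem)
  have "T ((4 *\<^sub>R (x * x - x)) ^ n) = 0" if n: "n > 0" for n
  proof -
    obtain m where "n = Suc m" using n by (cases n) auto
    then show ?thesis by (simp only: power_Suc mult zero mult_zero_left)
  qed
  then have "T (inv_sqrt_series (4 *\<^sub>R (x * x - x))) = 1"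
    using inv_sqrt_series_collapse[OF summ \<open>bounded_linear T\<close>] \<open>T 1 = 1\<close> by simp
  then show ?thesis
    by (simp add: idempotent_of_def T.add T.diff T.scaleR mult \<open>T 1 = 1\<close>)
qed

text \<open>Meant for the involution. The defect and hence its real power series are fixed; the
  reversed order of the product is repaired by \<open>idempotent_of_commute\<close>.\<close>

lemma idempotent_of_antihom:
  assumes "bounded_linear T" and mult: "\<And>a b. T (a * b) = T b * T a" and "T 1 = 1" and x: "T x = x"
  shows "T (idempotent_of x) = idempotent_of x"
proof -
  interpret T: bounded_linear T by fact
  have y: "T (4 *\<^sub>R (x * x - x)) = 4 *\<^sub>R (x * x - x)"
    by (simp only: T.scaleR T.diff mult x)
  have "T ((4 *\<^sub>R (x * x - x)) ^ n) = (4 *\<^sub>R (x * x - x)) ^ n" for n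
    by (induction n) (simp_all only: power_0 power_Suc mult y \<open>T 1 = 1\<close> power_Suc2[symmetric])
  then have "T (inv_sqrt_series (4 *\<^sub>R (x * x - x))) = inv_sqrt_series (4 *\<^sub>R (x * x - x))"
    using inv_sqrt_series_linear_image[OF summ \<open>bounded_linear T\<close>] by (simp add: inv_sqrt_series_def)
  then show ?thesis
    by (simp add: idempotent_of_def T.add T.diff T.scaleR mult x \<open>T 1 = 1\<close> idempotent_of_commute)
qed

end

lemma has_power_series_at_idempotent_of:
  fixes f :: "real \<Rightarrow> 'a::{real_normed_algebra_1, banach}"
  assumes f: "has_power_series_at f x\<^sub>0"
    and N: "N > 0" "norm ((4 *\<^sub>R (f x\<^sub>0 * f x\<^sub>0 - f x\<^sub>0)) ^ N) < 1"
  shows "has_power_series_at (\<lambda>x. idempotent_of (f x)) x\<^sub>0"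
    and "\<forall>\<^sub>F x in nhds x\<^sub>0. summable (\<lambda>n. norm ((4 *\<^sub>R (f x * f x - f x)) ^ n))"
proof -
  have y: "has_power_series_at (\<lambda>x. 4 *\<^sub>R (f x * f x - f x)) x\<^sub>0"
    by (intro has_power_series_at_bounded_linear[OF bounded_linear_scaleR_right]
        has_power_series_at_diff has_power_series_at_mult f)
  note series = has_power_series_at_series[OF abs_gbinomial_minus_half_le y N]
  show "has_power_series_at (\<lambda>x. idempotent_of (f x)) x\<^sub>0"
    unfolding idempotent_of_def inv_sqrt_series_def
    by (intro has_power_series_at_add has_power_series_at_mult has_power_series_at_diff
        has_power_series_at_const f series(1))
  show "\<forall>\<^sub>F x in nhds x\<^sub>0. summable (\<lambda>n. norm ((4 *\<^sub>R (f x * f x - f x)) ^ n))"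
    by (rule series(2))
qed

section \<open>Lifting orthogonal families\<close>

lemma involution_one:
  assumes "involution star"
  shows "star 1 = 1"
  using assms unfolding involution_def by (metis mult.left_neutral mult.right_neutral)

text \<open>\<open>bounded_linear\<close> means real linearity, which a conjugate-linear map has;
  the norm bound comes from continuity at 0 by rescaling.\<close>

lemma involution_bounded_linear:
  fixes star :: "'a::complex_banach_algebra_1 \<Rightarrow> 'a"
  assumes star: "involution star" and cont: "continuous_on UNIV star"
  shows "bounded_linear star"
proof -
  have add: "star (x + y) = star x + star y" for x y
    using star by (simp add: involution_def)
  have scaleR: "star (r *\<^sub>R x) = r *\<^sub>R star x" for r x
    using star unfolding involution_def by (metis complex_cnj_complex_of_real scaleC_of_real)
  have zero: "star 0 = 0"
    using scaleR[of 0 0] by simp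
  have "isCont star 0"
    using cont by (simp add: continuous_on_eq_continuous_at)
  then obtain d where d: "d > 0" "\<And>x. norm x < d \<Longrightarrow> norm (star x) < 1"
    unfolding continuous_at_eps_delta by (metis zero zero_less_one dist_0_norm dist_commute)
  have "norm (star x) \<le> norm x * (2 / d)" for x
  proof (cases "x = 0")
    case False
    define k where "k = d / (2 * norm x)"
    have k: "k > 0" using d(1) False by (simp add: k_def)
    have "norm (k *\<^sub>R x) < d" using d(1) False by (simp add: k_def)
    then have "k * norm (star x) < 1"
      using d(2)[of "k *\<^sub>R x"] k by (simp add: scaleR)
    then show ?thesis
      using d(1) False k by (simp add: k_def field_simps)
  qed (simp add: zero)
  then show ?thesis
    by (intro bounded_linear_intro[where K = "2 / d"] add scaleR)
qed

theorem theorem6: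
  fixes G :: "real set"
    and starA :: "'a::complex_banach_algebra_1 \<Rightarrow> 'a"
    and starB :: "'b::complex_banach_algebra_1 \<Rightarrow> 'b"
    and \<pi> :: "real \<Rightarrow> 'a \<Rightarrow>\<^sub>L 'b"
    and n :: nat
    and q :: "nat \<Rightarrow> real \<Rightarrow> 'b"
  assumes "open G" and "0 \<in> G"
    and "involution starA" and "continuous_on UNIV starA"
    and "involution starB" and "continuous_on UNIV starB"
    and "\<pi> real_analytic_on G"
    and "\<And>l. l \<in> G \<Longrightarrow> unital_star_hom starA starB (blinfun_apply (\<pi> l))"
    and "surj (blinfun_apply (\<pi> 0))"
    and "\<And>x. blinfun_apply (\<pi> 0) x = 0 \<Longrightarrow> spectrum x = {0}"
    and "\<And>i. i \<in> {1..n} \<Longrightarrow> q i real_analytic_on G"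
    and "\<And>i l. i \<in> {1..n} \<Longrightarrow> l \<in> G \<Longrightarrow> q i l \<in> selfadjoint_idempotents starB"
    and "\<And>i j l. i \<in> {1..n} \<Longrightarrow> j \<in> {1..n} \<Longrightarrow> i \<noteq> j \<Longrightarrow> l \<in> G \<Longrightarrow>
           orthogonal_idempotents (q i l) (q j l)"
  shows "\<exists>(H :: real set) (p :: nat \<Rightarrow> real \<Rightarrow> 'a).
           open H \<and> 0 \<in> H \<and> H \<subseteq> G \<and>
           (\<forall>i\<in>{1..n}. p i real_analytic_on H) \<and>
           (\<forall>i\<in>{1..n}. \<forall>l\<in>H. p i l \<in> selfadjoint_idempotents starA) \<and>
           (\<forall>i\<in>{1..n}. \<forall>j\<in>{1..n}. i \<noteq> j \<longrightarrow> (\<forall>l\<in>H. orthogonal_idempotents (p i l) (p j l))) \<and>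
           (\<forall>i\<in>{1..n}. \<forall>l\<in>H. blinfun_apply (\<pi> l) (p i l) = q i l)"
proof -
  note star = \<open>involution starA\<close>
  have blstar: "bounded_linear starA"
    using assms by (intro involution_bounded_linear)
  interpret star: bounded_linear starA by (rule blstar)
  have star_mult: "starA (x * y) = starA y * starA x" and star_star: "starA (starA x) = x" for x y
    using star by (simp_all add: involution_def)
  have star_one: "starA 1 = 1"
    using star by (rule involution_one)
  have hom_mult: "\<pi> l (x * y) = \<pi> l x * \<pi> l y" and hom_one: "\<pi> l 1 = 1"
    and hom_star: "\<pi> l (starA x) = starB (\<pi> l x)" if "l \<in> G" for l x y
    using assms(8)[OF that] by (simp_all add: unital_star_hom_def)
  have near_G: "\<forall>\<^sub>F l in nhds 0. l \<in> G"
    using assms(1,2) by (simp add: eventually_nhds_in_open)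
  have q_idem: "q i l * q i l = q i l" and q_star: "starB (q i l) = q i l" if "i \<in> {1..n}" "l \<in> G" for i l
    using assms(12)[OF that] by (simp_all add: selfadjoint_idempotents_def)
  have q_orth: "q i l * q j l = 0" if "i \<in> {1..n}" "j \<in> {1..n}" "i \<noteq> j" "l \<in> G" for i j l
    using assms(13)[OF that] by (simp add: orthogonal_idempotents_def)

  \<comment> \<open>Induction on the number of idempotents already lifted. Every stage may shrink
    the neighbourhood, so the algebraic relations are only claimed eventually near 0.\<close>
  have "\<exists>p. (\<forall>i\<in>{1..k}. has_power_series_at (p i) 0) \<and>
      (\<forall>\<^sub>F l in nhds 0. (\<forall>i\<in>{1..k}. p i l * p i l = p i l \<and> starA (p i l) = p i l \<and> \<pi> l (p i l) = q i l) \<and>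
        (\<forall>i\<in>{1..k}. \<forall>j\<in>{1..k}. i \<noteq> j \<longrightarrow> p i l * p j l = 0))"
    if "k \<le> n" for k
    using that
  proof (induction k)
    case 0
    show ?case by simp
  next
    case (Suc k)
    then obtain p where p_ps': "\<forall>i\<in>{1..k}. has_power_series_at (p i) 0"
      and p: "\<forall>\<^sub>F l in nhds 0. (\<forall>i\<in>{1..k}. p i l * p i l = p i l \<and> starA (p i l) = p i l \<and> \<pi> l (p i l) = q i l) \<and>
        (\<forall>i\<in>{1..k}. \<forall>j\<in>{1..k}. i \<noteq> j \<longrightarrow> p i l * p j l = 0)"
      using Suc_leD by blast
    then have p_ps: "has_power_series_at (p i) 0" if "i \<in> {1..k}" for i
      using that by blast
    have m: "Suc k \<in> {1..n}" using Suc.prems by simp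
    obtain x where x_ps: "has_power_series_at x 0" and x: "\<forall>\<^sub>F l in nhds 0. \<pi> l (x l) = q (Suc k) l"
      using has_power_series_at_lift[of \<pi> 0 "q (Suc k)"] assms(2,7,9) assms(11)[OF m]
      unfolding real_analytic_on_iff by blast
    define x' where "x' l = (1 / 2) *\<^sub>R (x l + starA (x l))" for l
    define u where "u l = 1 - (\<Sum>i\<in>{1..k}. p i l)" for l
    define y where "y l = u l * x' l * u l" for l
    have y_ps: "has_power_series_at y 0"
      unfolding y_def x'_def u_def
      by (intro has_power_series_at_mult has_power_series_at_diff has_power_series_at_const
          has_power_series_at_sum has_power_series_at_add x_ps p_ps
          has_power_series_at_bounded_linear[OF bounded_linear_scaleR_right]
          has_power_series_at_bounded_linear[OF blstar])
    have y: "\<forall>\<^sub>F l in nhds 0. starA (y l) = y l \<and> \<pi> l (y l) = q (Suc k) l \<and>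
        (\<forall>i\<in>{1..k}. p i l * y l = 0 \<and> y l * p i l = 0)"
      using p x near_G
    proof eventually_elim
      case (elim l)
      then have pl: "p i l * p i l = p i l" "starA (p i l) = p i l" "\<pi> l (p i l) = q i l" if "i \<in> {1..k}" for i
        using that by auto
      have orth: "p i l * p j l = (if i = j then p i l else 0)" if "i \<in> {1..k}" "j \<in> {1..k}" for i j
        using that elim by auto
      have star_x': "starA (x' l) = x' l"
        by (simp add: x'_def star.scaleR star.add star_star add.commute)
      have star_u: "starA (u l) = u l"
        by (simp add: u_def star.diff star.sum star_one pl(2))
      have "\<pi> l (x' l) = (1 / 2) *\<^sub>R (q (Suc k) l + q (Suc k) l)"
        using elim q_star[OF m] by (simp add: x'_def blinfun.scaleR_right blinfun.add_right hom_star)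
      then have pix: "\<pi> l (x' l) = q (Suc k) l"
        by (simp flip: scaleR_2)
      have piu: "\<pi> l (u l) = 1 - (\<Sum>i\<in>{1..k}. q i l)"
        using elim by (simp add: u_def blinfun.diff_right blinfun.sum_right hom_one pl(3))
      \<comment> \<open>Orthogonality of the \<open>q i\<close> makes the image of
        \<open>u l\<close> act as a unit on \<open>q (Suc k) l\<close> from both sides, so the
        cut-down element still maps to it.\<close>
      have "(\<Sum>i\<in>{1..k}. q i l) * q (Suc k) l = 0" "q (Suc k) l * (\<Sum>i\<in>{1..k}. q i l) = 0"
        unfolding sum_distrib_left sum_distrib_right
        using elim Suc.prems by (auto intro!: sum.neutral q_orth)
      then have piy: "\<pi> l (y l) = q (Suc k) l"
        using elim by (simp add: y_def hom_mult piu pix algebra_simps)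
      have pu: "p i l * u l = 0" "u l * p i l = 0" if "i \<in> {1..k}" for i
      proof -
        have "(\<Sum>j\<in>{1..k}. p i l * p j l) = (\<Sum>j\<in>{1..k}. if i = j then p i l else 0)"
          using that by (intro sum.cong orth) auto
        then show "p i l * u l = 0"
          using that by (simp add: u_def right_diff_distrib sum_distrib_left)
        have "(\<Sum>j\<in>{1..k}. p j l * p i l) = (\<Sum>j\<in>{1..k}. if j = i then p j l else 0)"
          using that by (intro sum.cong orth) auto
        then show "u l * p i l = 0"
          using that by (simp add: u_def left_diff_distrib sum_distrib_right)
      qed
      have "p i l * y l = 0 \<and> y l * p i l = 0" if "i \<in> {1..k}" for i
      proof -
        have "p i l * y l = (p i l * u l) * (x' l * u l)" "y l * p i l = u l * x' l * (u l * p i l)"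
          by (simp_all add: y_def mult.assoc)
        then show ?thesis using pu[OF that] by simp
      qed
      moreover have "starA (y l) = y l"
        by (simp add: y_def star_mult star_u star_x' mult.assoc)
      ultimately show ?case using piy by blast
    qed
    \<comment> \<open>Quasinilpotency of the defect is used at 0 only; the exponent \<open>N\<close>
      found there controls a whole neighbourhood.\<close>
    have "\<pi> 0 (y 0) = q (Suc k) 0"
      using eventually_nhds_x_imp_x[OF y] by blast
    then have "\<pi> 0 (y 0 * y 0 - y 0) = 0"
      using assms(2) q_idem[OF m] by (simp add: blinfun.diff_right hom_mult)
    then have "spectrum (y 0 * y 0 - y 0) \<subseteq> {0}"
      using assms(10) by blast
    then obtain N where N: "N > 0" "norm ((4 *\<^sub>R (y 0 * y 0 - y 0)) ^ N) < 1"
      by (rule quasinilpotent_scaled_power_norm_less[where e = 1 and c = 4]) auto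
    define p' where "p' = p(Suc k := (\<lambda>l. idempotent_of (y l)))"
    have "has_power_series_at (p' i) 0" if "i \<in> {1..Suc k}" for i
      using that p_ps has_power_series_at_idempotent_of(1)[OF y_ps N] by (auto simp: p'_def)
    moreover have "\<forall>\<^sub>F l in nhds 0.
        (\<forall>i\<in>{1..Suc k}. p' i l * p' i l = p' i l \<and> starA (p' i l) = p' i l \<and> \<pi> l (p' i l) = q i l) \<and>
        (\<forall>i\<in>{1..Suc k}. \<forall>j\<in>{1..Suc k}. i \<noteq> j \<longrightarrow> p' i l * p' j l = 0)"
      using p y near_G has_power_series_at_idempotent_of(2)[OF y_ps N]
    proof eventually_elim
      case (elim l)
      let ?e = "idempotent_of (y l)"
      have y_idem: "\<pi> l (y l) * \<pi> l (y l) = \<pi> l (y l)"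
        using elim q_idem[OF m] by simp
      have "?e * ?e = ?e"
        using elim(4) by (rule idempotent_of_idempotent)
      moreover have "starA ?e = ?e"
        using elim blstar star_mult star_one by (intro idempotent_of_antihom) auto
      moreover have "\<pi> l ?e = q (Suc k) l"
        using idempotent_of_hom[OF elim(4) blinfun.bounded_linear_right hom_mult hom_one y_idem] elim
        by simp
      moreover have "p i l * ?e = 0" "?e * p i l = 0" if "i \<in> {1..k}" for i
        using elim that
        by (auto intro: idempotent_of_annihilated_left idempotent_of_annihilated_right)
      moreover have "{1..Suc k} = insert (Suc k) {1..k}" by auto
      moreover have "p' (Suc k) l = ?e" "\<And>i. i \<in> {1..k} \<Longrightarrow> p' i l = p i l"
        by (auto simp: p'_def)
      ultimately show ?case using elim(1) by simp
    qed
    ultimately show ?case by blast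
  qed
  from this[OF order_refl] obtain p where p_ps: "\<And>i. i \<in> {1..n} \<Longrightarrow> has_power_series_at (p i) 0"
    and p: "\<forall>\<^sub>F l in nhds 0. (\<forall>i\<in>{1..n}. p i l * p i l = p i l \<and> starA (p i l) = p i l \<and> \<pi> l (p i l) = q i l) \<and>
      (\<forall>i\<in>{1..n}. \<forall>j\<in>{1..n}. i \<noteq> j \<longrightarrow> p i l * p j l = 0)"
    by blast
  define P where "P l \<longleftrightarrow> l \<in> G \<and> (\<forall>i\<in>{1..n}. has_power_series_at (p i) l) \<and>
      (\<forall>i\<in>{1..n}. p i l * p i l = p i l \<and> starA (p i l) = p i l \<and> \<pi> l (p i l) = q i l) \<and>
      (\<forall>i\<in>{1..n}. \<forall>j\<in>{1..n}. i \<noteq> j \<longrightarrow> p i l * p j l = 0)" for l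
  \<comment> \<open>So far each \<open>p i\<close> has an expansion at the single point 0, whereas
    analyticity on \<open>H\<close> demands one at every point of \<open>H\<close>.\<close>
  have "\<forall>\<^sub>F l in nhds 0. \<forall>i\<in>{1..n}. has_power_series_at (p i) l"
    using p_ps by (simp add: eventually_ball_finite eventually_has_power_series_at)
  with near_G p have "eventually P (nhds 0)"
    unfolding P_def by eventually_elim blast
  then obtain H where H: "open H" "0 \<in> H" "\<And>l. l \<in> H \<Longrightarrow> P l"
    unfolding eventually_nhds by blast
  show ?thesis
  proof (intro exI[of _ H] exI[of _ p] conjI)
    show "H \<subseteq> G" "\<forall>i\<in>{1..n}. p i real_analytic_on H"
      "\<forall>i\<in>{1..n}. \<forall>l\<in>H. p i l \<in> selfadjoint_idempotents starA"
      "\<forall>i\<in>{1..n}. \<forall>l\<in>H. \<pi> l (p i l) = q i l"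
      using H(3) by (auto simp: P_def real_analytic_on_iff selfadjoint_idempotents_def)
    show "\<forall>i\<in>{1..n}. \<forall>j\<in>{1..n}. i \<noteq> j \<longrightarrow> (\<forall>l\<in>H. orthogonal_idempotents (p i l) (p j l))"
      using H(3) unfolding P_def orthogonal_idempotents_def by metis
  qed (rule H)+
qed

end
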